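(* Let $A,B\in\mathbb P_n$, let $a,b\ge 0$, and let $0\le c\le 2ab$. Put $H^{\natural,c}_{a,b}(A,B)=a^2A+b^2B+c(A\natural B)$ and $W_{a,b}(A,B)=a^2A+b^2B+ab\bigl((AB)^{1/2}+(BA)^{1/2}\bigr)$. Then $$\lambda\bigl(H^{\natural,c}_{a,b}(A,B)\bigr)\prec_w\lambda\bigl(W_{a,b}(A,B)\bigr).$$ Consequently, $\|H^{\natural,c}_{a,b}(A,B)\|\le\|W_{a,b}(A,B)\|$ for every unitarily invariant norm $\|\cdot\|$ on $n\times n$ complex matrices. For $c=2ab$ one has the majorization $$\lambda\bigl(H^{\natural,2ab}_{a,b}(A,B)\bigr)\prec\lambda\bigl(W_{a,b}(A,B)\bigr).$$ Moreover, for fixed $a,b>0$ the upper coefficient $2ab$ is sharp among nonnegative coefficients, already in dimension one: for every $c>2ab$ there exist $A,B\in\mathbb P_1$ for which $\lambda\bigl(H^{\natural,c}_{a,b}(A,B)\bigr)\prec_w\lambda\bigl(W_{a,b}(A,B)\bigr)$ fails.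
   Context: $\mathbb P_n$ is the set of $n\times n$ complex (Hermitian) positive definite matrices. For a Hermitian matrix $T$, $\lambda(T)=(\lambda_1^\downarrow(T),\dots,\lambda_n^\downarrow(T))$ is the vector of eigenvalues in decreasing order. For $x,y\in\mathbb R^n$ with decreasing rearrangements $x^\downarrow,y^\downarrow$, $x\prec_w y$ means $\sum_{j=1}^k x_j^\downarrow\le\sum_{j=1}^k y_j^\downarrow$ for all $1\le k\le n$, and $x\prec y$ means in addition equality for $k=n$. For $P,Q\in\mathbb P_n$, $P\#Q=P^{1/2}(P^{-1/2}QP^{-1/2})^{1/2}P^{1/2}$ is the Kubo-Ando geometric mean and $A\natural B=(A^{-1}\#B)^{1/2}A(A^{-1}\#B)^{1/2}$ is the spectral geometric mean. For $A,B\in\mathbb P_n$ the product $AB$ has positive spectrum and $(AB)^{1/2}$ denotes its principal square root (the unique square root with spectrum in $(0,\infty)$); the sum $(AB)^{1/2}+(BA)^{1/2}$ is Hermitian. *)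

theory Defs
  imports
    "Jordan_Normal_Form.Schur_Decomposition"
    "Jordan_Normal_Form.Spectral_Radius"
    "Jordan_Normal_Form.Gauss_Jordan_Elimination"
    "HOL-Library.Multiset"
begin

definition posdef_mats :: "nat \<Rightarrow> complex mat set" where
  "posdef_mats n = {A \<in> carrier_mat n n. mat_adjoint A = A \<and>
     (\<forall>v \<in> carrier_vec n. v \<noteq> 0\<^sub>v n \<longrightarrow> 0 < Re ((A *\<^sub>v v) \<bullet>c v))}"

definition unitary_mats :: "nat \<Rightarrow> complex mat set" where
  "unitary_mats n = {U \<in> carrier_mat n n.
     mat_adjoint U * U = 1\<^sub>m n \<and> U * mat_adjoint U = 1\<^sub>m n}"

(* Meaningful only for invertible square matrices, since mat_inverse is option-valued. *)
definition minv :: "complex mat \<Rightarrow> complex mat" where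
  "minv A = the (mat_inverse A)"

definition pd_sqrt :: "complex mat \<Rightarrow> complex mat" where
  "pd_sqrt P = (THE Q. Q \<in> posdef_mats (dim_row P) \<and> Q * Q = P)"

(* Principal square root of a matrix with spectrum in (0, infinity). Neither the matrix nor its
   root need be Hermitian: this is used for the product of two positive definite matrices. *)
definition principal_sqrt :: "complex mat \<Rightarrow> complex mat" where
  "principal_sqrt X = (THE Y. Y \<in> carrier_mat (dim_row X) (dim_row X) \<and> Y * Y = X \<and>
     spectrum Y \<subseteq> complex_of_real ` {0<..})"

definition geometric_mean :: "complex mat \<Rightarrow> complex mat \<Rightarrow> complex mat" where
  "geometric_mean P Q =
     pd_sqrt P * pd_sqrt (minv (pd_sqrt P) * Q * minv (pd_sqrt P)) * pd_sqrt P"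

definition spectral_geometric_mean :: "complex mat \<Rightarrow> complex mat \<Rightarrow> complex mat" where
  "spectral_geometric_mean A B =
     pd_sqrt (geometric_mean (minv A) B) * A * pd_sqrt (geometric_mean (minv A) B)"

definition H_mat :: "real \<Rightarrow> real \<Rightarrow> real \<Rightarrow> complex mat \<Rightarrow> complex mat \<Rightarrow> complex mat" where
  "H_mat c a b A B = complex_of_real (a\<^sup>2) \<cdot>\<^sub>m A + complex_of_real (b\<^sup>2) \<cdot>\<^sub>m B
     + complex_of_real c \<cdot>\<^sub>m spectral_geometric_mean A B"

definition W_mat :: "real \<Rightarrow> real \<Rightarrow> complex mat \<Rightarrow> complex mat \<Rightarrow> complex mat" where
  "W_mat a b A B = complex_of_real (a\<^sup>2) \<cdot>\<^sub>m A + complex_of_real (b\<^sup>2) \<cdot>\<^sub>m B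
     + complex_of_real (a * b) \<cdot>\<^sub>m (principal_sqrt (A * B) + principal_sqrt (B * A))"

definition decreasing :: "real list \<Rightarrow> real list" where
  "decreasing x = rev (sort x)"

(* Eigenvalues of a Hermitian matrix with algebraic multiplicity, in decreasing order. They are
   real, so Re only changes the type. *)
definition eigvals_dec :: "complex mat \<Rightarrow> real list" where
  "eigvals_dec T = rev (sorted_list_of_multiset (image_mset Re (proots (char_poly T))))"

(* Vectors of R^n are real lists of length n. *)
definition weakly_majorized :: "real list \<Rightarrow> real list \<Rightarrow> bool" (infix \<open>\<prec>\<^sub>w\<close> 50) where
  "x \<prec>\<^sub>w y \<longleftrightarrow> length x = length y \<and>
     (\<forall>k \<in> {1..length x}. sum_list (take k (decreasing x)) \<le> sum_list (take k (decreasing y)))"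

definition majorized :: "real list \<Rightarrow> real list \<Rightarrow> bool" (infix \<open>\<prec>\<^sub>m\<close> 50) where
  "x \<prec>\<^sub>m y \<longleftrightarrow> x \<prec>\<^sub>w y \<and> sum_list x = sum_list y"

(* Values of N outside carrier_mat n n are unconstrained. *)
definition unitarily_invariant_norm :: "nat \<Rightarrow> (complex mat \<Rightarrow> real) \<Rightarrow> bool" where
  "unitarily_invariant_norm n N \<longleftrightarrow>
     (\<forall>X \<in> carrier_mat n n. 0 \<le> N X) \<and>
     (\<forall>X \<in> carrier_mat n n. N X = 0 \<longleftrightarrow> X = 0\<^sub>m n n) \<and>
     (\<forall>X \<in> carrier_mat n n. \<forall>z. N (z \<cdot>\<^sub>m X) = cmod z * N X) \<and>
     (\<forall>X \<in> carrier_mat n n. \<forall>Y \<in> carrier_mat n n. N (X + Y) \<le> N X + N Y) \<and>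
     (\<forall>X \<in> carrier_mat n n. \<forall>U \<in> unitary_mats n. \<forall>V \<in> unitary_mats n. N (U * X * V) = N X)"

end

theory Submission
  imports Defs "HOL-Combinatorics.List_Permutation"
begin

text \<open>The comparison rests on an explicit formula that writes \<open>H = H_mat c a b A B\<close> as an average of
matrices \<open>U W V\<close> with \<open>W = W_mat a b A B\<close> and unitary \<open>U\<close> and \<open>V\<close>.

Let \<open>G = A\<^sup>-\<^sup>1 # B\<close>, \<open>S = G\<^sup>1\<^sup>/\<^sup>2\<close> and let \<open>C = S A S\<close> be the spectral geometric mean. The
Riccati equation \<open>G A G = B\<close> turns into \<open>A = S\<^sup>-\<^sup>1 C S\<^sup>-\<^sup>1\<close> and \<open>B = S C S\<close>, so
\<open>A B = S\<^sup>-\<^sup>1 C\<^sup>2 S\<close>, whose principal square root is \<open>S\<^sup>-\<^sup>1 C S\<close>. Consequently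
\<open>W = L C L\<close> with \<open>L = a S\<^sup>-\<^sup>1 + b S\<close>, while
\<open>H = a\<^sup>2 S\<^sup>-\<^sup>1 C S\<^sup>-\<^sup>1 + b\<^sup>2 S C S + c C\<close>.

If \<open>a = b = 0\<close> then both matrices vanish; otherwise \<open>L\<close> is positive definite. Put \<open>X = a S\<^sup>-\<^sup>1 - b S\<close>. All functions of \<open>S\<close> commute and \<open>X\<^sup>2 + 4 a b I = L\<^sup>2\<close>, so
\<open>E = (X + 2 \<i> sqrt (a b) I) L\<^sup>-\<^sup>1\<close> is unitary. Expanding products gives
\<open>E W E\<^sup>* + E\<^sup>* W E = 2 X C X + 8 a b C\<close>, \<open>E W E + E\<^sup>* W E\<^sup>* = 2 X C X - 8 a b C\<close> and
\<open>L C L + X C X = 2 a\<^sup>2 S\<^sup>-\<^sup>1 C S\<^sup>-\<^sup>1 + 2 b\<^sup>2 S C S\<close>. Hence, with \<open>t = (1 + c / (2 a b)) / 2\<close>,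
which lies between 0 and 1 because \<open>0 \<le> c \<le> 2 a b\<close> (and with \<open>t = 1/2\<close> if \<open>a b = 0\<close>),

  \<open>H = W/2 + (t (E W E\<^sup>* + E\<^sup>* W E)/2 + (1 - t) (E W E + E\<^sup>* W E\<^sup>*)/2) / 2\<close>.

This is \<open>diagonal_weights_mixture\<close>, computed in an eigenbasis of \<open>S\<close>. A unitarily invariant norm
cannot increase under such an average (\<open>unitarily_invariant_norm_mixture_le\<close>), and neither can the
sum of the \<open>k\<close> largest eigenvalues, by a Ky Fan type estimate
(\<open>unitary_mixture_weakly_majorized\<close>). For \<open>c = 2 a b\<close> the diagonals of \<open>H\<close> and \<open>W\<close> in the
eigenbasis of \<open>S\<close> agree, so the traces agree and weak majorization becomes majorization. Sharpness
is visible at \<open>A = B = 1\<close>, where \<open>H = a\<^sup>2 + b\<^sup>2 + c\<close> and \<open>W = (a + b)\<^sup>2\<close>.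

The square roots in these definitions are definite descriptions, so the argument also needs the
spectral theorem for existence and a uniqueness statement for roots with positive spectrum; the
latter is the injectivity of a Sylvester operator (\<open>sylvester_zero\<close>).\<close>

section \<open>Adjoints and unitary matrices\<close>

lemma mat_mult_index:
  assumes "A \<in> carrier_mat m n" "B \<in> carrier_mat n p" "i < m" "j < p"
  shows "(A * B) $$ (i,j) = (\<Sum>k<n. A $$ (i,k) * B $$ (k,j))"
  using assms by (auto simp: scalar_prod_def lessThan_atLeast0 intro!: sum.cong)

lemma mat_adjoint_carrier [simp, intro]:
  "A \<in> carrier_mat m n \<Longrightarrow> mat_adjoint A \<in> carrier_mat n m"
  unfolding mat_adjoint_def mat_of_rows_def carrier_mat_def by auto

lemma mat_adjoint_dim [simp]:
  "dim_row (mat_adjoint A) = dim_col A" "dim_col (mat_adjoint A) = dim_row A"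
  by (auto simp: mat_adjoint_def)

lemma mat_adjoint_index [simp]:
  "i < dim_col A \<Longrightarrow> j < dim_row A \<Longrightarrow> mat_adjoint A $$ (i,j) = cnj (A $$ (j,i))"
  by (simp add: mat_adjoint_def mat_of_rows_def)

lemma mat_adjoint_adjoint [simp]: "mat_adjoint (mat_adjoint (A :: complex mat)) = A"
  by (rule eq_matI) auto

lemma mat_adjoint_mult:
  assumes "(A :: complex mat) \<in> carrier_mat m n" "B \<in> carrier_mat n p"
  shows "mat_adjoint (A * B) = mat_adjoint B * mat_adjoint A"
  using assms
  by (intro eq_matI) (auto simp: mat_mult_index[OF assms] mult.commute
        mat_mult_index[OF mat_adjoint_carrier[OF assms(2)] mat_adjoint_carrier[OF assms(1)]] simp del: index_mult_mat(1)
        intro!: sum.cong)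

lemma mat_adjoint_one [simp]: "mat_adjoint (1\<^sub>m n :: complex mat) = 1\<^sub>m n"
  by (rule eq_matI) auto

lemma mat_adjoint_mat_diag: "mat_adjoint (mat_diag n f) = mat_diag n (\<lambda>i. cnj (f i))"
  by (rule eq_matI) (auto simp: mat_diag_def)

lemma inner_mat_adjoint:
  assumes "(A :: complex mat) \<in> carrier_mat m n" "v \<in> carrier_vec n" "w \<in> carrier_vec m"
  shows "(A *\<^sub>v v) \<bullet>c w = v \<bullet>c (mat_adjoint A *\<^sub>v w)"
proof -
  have "(A *\<^sub>v v) \<bullet>c w = (\<Sum>i<m. (\<Sum>k<n. A $$ (i,k) * v $ k) * cnj (w $ i))"
    using assms by (auto simp: scalar_prod_def lessThan_atLeast0 intro!: sum.cong)
  also have "\<dots> = (\<Sum>k<n. \<Sum>i<m. A $$ (i,k) * v $ k * cnj (w $ i))"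
    unfolding sum_distrib_right by (rule sum.swap)
  also have "\<dots> = v \<bullet>c (mat_adjoint A *\<^sub>v w)"
    using assms
    by (auto simp: scalar_prod_def lessThan_atLeast0 sum_distrib_left mult_ac intro!: sum.cong)
  finally show ?thesis .
qed

lemma unitary_matsD:
  assumes "U \<in> unitary_mats n"
  shows "U \<in> carrier_mat n n" "mat_adjoint U \<in> carrier_mat n n"
    "mat_adjoint U * U = 1\<^sub>m n" "U * mat_adjoint U = 1\<^sub>m n"
  using assms by (auto simp: unitary_mats_def)

lemma unitary_mats_adjoint: "U \<in> unitary_mats n \<Longrightarrow> mat_adjoint U \<in> unitary_mats n"
  by (auto simp: unitary_mats_def)

text \<open>The general rules for products leave the inner dimensions open, so as rewrite rules they cannot
discharge their own carrier conditions on nested products. The square versions can, once the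
dimension is supplied.\<close>

lemma mult_sq_carrier:
  "A \<in> carrier_mat n n \<Longrightarrow> B \<in> carrier_mat n n \<Longrightarrow> A * B \<in> carrier_mat n n"
  by simp

lemma mult_sq_assoc:
  fixes A B C :: "complex mat"
  assumes "A \<in> carrier_mat n n" "B \<in> carrier_mat n n" "C \<in> carrier_mat n n"
  shows "(A * B) * C = A * (B * C)"
  using assms by simp

lemma mult_cancel:
  fixes P Q X :: "complex mat"
  assumes "P * Q = 1\<^sub>m n" "P \<in> carrier_mat n n" "Q \<in> carrier_mat n n" "X \<in> carrier_mat n n"
  shows "P * (Q * X) = X"
  using assoc_mult_mat[OF assms(2-4)] left_mult_one_mat[OF assms(4)] assms(1) by metis

lemma one_in_unitary_mats: "1\<^sub>m n \<in> unitary_mats n"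
  by (auto simp: unitary_mats_def)

lemma unitary_mats_mult:
  assumes "U \<in> unitary_mats n" "V \<in> unitary_mats n"
  shows "U * V \<in> unitary_mats n"
proof -
  note U = unitary_matsD[OF assms(1)] and V = unitary_matsD[OF assms(2)]
  show ?thesis
    using U V by (simp add: unitary_mats_def mat_adjoint_mult[OF U(1) V(1)]
        mult_sq_assoc[of _ n] mult_sq_carrier[of _ n] mult_cancel[OF U(3)] mult_cancel[OF V(4)]
        mult_cancel[OF U(4)] mult_cancel[OF V(3)] del: assoc_mult_mat)
qed

lemma mat_diag_in_unitary_mats:
  assumes "\<And>i. i < n \<Longrightarrow> cmod (e i) = 1"
  shows "mat_diag n e \<in> unitary_mats n"
proof -
  have "e i * cnj (e i) = 1" if "i < n" for i
    using assms[OF that] by (simp add: complex_norm_square[symmetric])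
  then have "mat_diag n (\<lambda>i. e i * cnj (e i)) = 1\<^sub>m n" "mat_diag n (\<lambda>i. cnj (e i) * e i) = 1\<^sub>m n"
    by (auto intro!: eq_matI simp: mat_diag_def mult.commute)
  then show ?thesis
    by (auto simp: unitary_mats_def mat_adjoint_mat_diag)
qed

lemma unitary_row_sum:
  assumes "U \<in> unitary_mats n" "i < n"
  shows "(\<Sum>j<n. (cmod (U $$ (i,j)))\<^sup>2) = 1"
proof -
  note U = unitary_matsD[OF assms(1)]
  have "complex_of_real (\<Sum>j<n. (cmod (U $$ (i,j)))\<^sup>2) = (U * mat_adjoint U) $$ (i,i)"
    using U(1) assms(2)
    by (simp add: mat_mult_index[OF U(1,2) assms(2) assms(2)] complex_norm_square del: index_mult_mat(1) of_real_power)
  also have "\<dots> = 1" using U assms(2) by simp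
  finally show ?thesis using of_real_eq_1_iff by blast
qed

lemma unitary_col_sum:
  assumes "U \<in> unitary_mats n" "j < n"
  shows "(\<Sum>i<n. (cmod (U $$ (i,j)))\<^sup>2) = 1"
  using unitary_row_sum[OF unitary_mats_adjoint[OF assms(1)] assms(2)] unitary_matsD(1)[OF assms(1)] assms(2)
  by simp

section \<open>The spectral theorem for Hermitian matrices\<close>

text \<open>The reflection that exchanges \<open>v\<close> and the first basis vector \<open>e\<^sub>0\<close> is \<open>I - 2 w w\<^sup>* / (w\<^sup>* w)\<close> with
\<open>w = v - e\<^sub>0\<close>. It maps one to the other only if \<open>v\<^sup>* e\<^sub>0\<close> is real, which is the reason for the
condition on the first entry.\<close>

lemma householder_reflection:
  fixes v :: "complex vec"
  assumes v: "v \<in> carrier_vec n" and n: "0 < n"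
    and unit: "(\<Sum>i<n. (cmod (v $ i))\<^sup>2) = 1" and real: "v $ 0 \<in> \<real>"
  obtains U where "U \<in> unitary_mats n" "mat_adjoint U = U" "col U 0 = v"
proof -
  define r where "r = Re (v $ 0)"
  have v0: "v $ 0 = of_real r" using real by (simp add: r_def)
  define w where "w i = v $ i - (if i = 0 then 1 else 0)" for i
  have w2: "(\<Sum>i<n. (cmod (w i))\<^sup>2) = 2 * (1 - r)"
  proof -
    have "(\<Sum>i<n. (cmod (w i))\<^sup>2) = (\<Sum>i<n. (cmod (v $ i))\<^sup>2 + (if i = 0 then 1 - 2 * r else 0))"
      by (rule sum.cong) (auto simp: w_def v0 cmod_power2, simp add: power2_eq_square algebra_simps)
    also have "\<dots> = 2 * (1 - r)" using n unit by (simp add: sum.distrib)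
    finally show ?thesis .
  qed
  \<comment> \<open>Half of \<open>w\<^sup>* w\<close>. If it vanishes then \<open>w = 0\<close>, and division by zero makes \<open>U\<close> the identity,
    which is the right reflection in that case.\<close>
  define t where "t = complex_of_real (1 - r)"
  define U where "U = mat n n (\<lambda>(i,j). (if i = j then 1 else 0) - w i * cnj (w j) / t)"
  have Uc: "U \<in> carrier_mat n n" by (simp add: U_def)
  have w2c: "(\<Sum>i<n. w i * cnj (w i)) = 2 * t"
    using arg_cong[OF w2, of complex_of_real] by (simp add: t_def complex_norm_square del: of_real_power)
  have herm: "mat_adjoint U = U"
    by (rule eq_matI) (auto simp: U_def t_def)
  have t0: "w i = 0" if "t = 0" "i < n" for i
  proof -
    have "(\<Sum>i<n. (cmod (w i))\<^sup>2) = 0" using w2 that by (simp add: t_def)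
    then have "(cmod (w i))\<^sup>2 = 0" using that(2) by (subst (asm) sum_nonneg_eq_0_iff) auto
    then show ?thesis by simp
  qed
  have UU: "U * U = 1\<^sub>m n"
  proof (rule eq_matI)
    fix i j assume "i < dim_row (1\<^sub>m n :: complex mat)" "j < dim_col (1\<^sub>m n :: complex mat)"
    then have ij: "i < n" "j < n" by auto
    define c where "c = w i * cnj (w j) / t"
    have "(U * U) $$ (i,j) = (\<Sum>k<n. ((if i = k then 1 else 0) - w i * cnj (w k) / t) *
        ((if k = j then 1 else 0) - w k * cnj (w j) / t))"
      unfolding mat_mult_index[OF Uc Uc ij] using ij by (auto simp: U_def intro!: sum.cong)
    also have "\<dots> = (\<Sum>k<n. (if k = i then (if i = j then 1 else 0) - c else 0)
        - (if k = j then c else 0) + c / t * (w k * cnj (w k)))"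
      by (rule sum.cong) (auto simp: c_def algebra_simps)
    also have "\<dots> = (if i = j then 1 else 0) - 2 * c + c / t * (\<Sum>k<n. w k * cnj (w k))"
      using ij by (simp add: sum.distrib sum_subtractf sum_distrib_left)
    also have "\<dots> = (1\<^sub>m n) $$ (i,j)"
      unfolding w2c using ij by (auto simp: c_def)
    finally show "(U * U) $$ (i,j) = (1\<^sub>m n) $$ (i,j)" .
  qed (use Uc in auto)
  have col: "col U 0 = v"
  proof (rule eq_vecI)
    fix i assume "i < dim_vec v"
    then have i: "i < n" using v by simp
    have c: "cnj (w 0) = - t" by (simp add: w_def v0 t_def)
    have "col U 0 $ i = (if i = 0 then 1 else 0) - w i * cnj (w 0) / t"
      using i n by (auto simp: U_def)
    also have "w i * cnj (w 0) / t = - w i"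
      unfolding c using t0[of i] i by auto
    finally show "col U 0 $ i = v $ i" by (simp add: w_def)
  qed (use Uc v in auto)
  show ?thesis
    by (rule that[of U]) (use herm UU col Uc in \<open>auto simp: unitary_mats_def\<close>)
qed

text \<open>An eigenvector may be multiplied by a phase, so its first entry can be made real as the Householder
reflection requires.\<close>

lemma exists_unit_eigenvector:
  fixes T :: "complex mat"
  assumes T: "T \<in> carrier_mat n n" and n: "0 < n"
  obtains u k where "u \<in> carrier_vec n" "(\<Sum>i<n. (cmod (u $ i))\<^sup>2) = 1" "u $ 0 \<in> \<real>"
    "T *\<^sub>v u = k \<cdot>\<^sub>v u"
proof -
  obtain k where "eigenvalue T k"
    using spectrum_non_empty[OF T n] by (auto simp: spectrum_def)
  then obtain v where v: "v \<in> carrier_vec n" "v \<noteq> 0\<^sub>v n" "T *\<^sub>v v = k \<cdot>\<^sub>v v"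
    using T by (auto simp: eigenvalue_def eigenvector_def)
  define q where "q = (\<Sum>i<n. (cmod (v $ i))\<^sup>2)"
  have q: "q > 0"
  proof -
    obtain i where i: "i < n" "v $ i \<noteq> 0"
      using v(1,2) by (metis carrier_vecD eq_vecI index_zero_vec)
    then have "0 < (cmod (v $ i))\<^sup>2" by simp
    also have "\<dots> \<le> q" unfolding q_def using i by (intro member_le_sum) auto
    finally show ?thesis .
  qed
  define z where "z = (if v $ 0 = 0 then 1 else cnj (v $ 0) / cmod (v $ 0)) / sqrt q"
  have z: "cmod z = 1 / sqrt q"
    using q by (auto simp: z_def norm_divide)
  define u where "u = z \<cdot>\<^sub>v v"
  show ?thesis
  proof (rule that[of u k])
    show "u \<in> carrier_vec n" using v by (simp add: u_def)
    have "(\<Sum>i<n. (cmod (u $ i))\<^sup>2) = (\<Sum>i<n. (cmod (v $ i))\<^sup>2 * (1 / q))"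
      using v(1) q by (intro sum.cong) (auto simp: u_def norm_mult z power_mult_distrib power_divide)
    also have "\<dots> = 1" unfolding sum_distrib_right[symmetric] q_def[symmetric] using q by simp
    finally show "(\<Sum>i<n. (cmod (u $ i))\<^sup>2) = 1" .
    have "u $ 0 = complex_of_real (cmod (v $ 0) / sqrt q)"
      using v(1) n by (auto simp: u_def z_def complex_norm_square[symmetric] mult.commute[of "cnj _"]
          power2_eq_square)
    then show "u $ 0 \<in> \<real>" by (metis Reals_of_real)
    show "T *\<^sub>v u = k \<cdot>\<^sub>v u"
      using v T by (simp add: u_def mult_mat_vec smult_smult_assoc mult.commute)
  qed
qed

abbreviation real_diag :: "nat \<Rightarrow> (nat \<Rightarrow> real) \<Rightarrow> complex mat" where
  "real_diag n d \<equiv> mat_diag n (\<lambda>i. complex_of_real (d i))"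

text \<open>Induction on the dimension. A Householder reflection moves a unit eigenvector to the first
coordinate; in the new basis the first column vanishes below the diagonal, hence, the matrix being
Hermitian, so does the first row to the right of it, and the induction hypothesis applies to the
remaining block.\<close>

theorem hermitian_spectral_decomposition:
  assumes "T \<in> carrier_mat n n" "mat_adjoint T = (T :: complex mat)"
  shows "\<exists>U \<in> unitary_mats n. \<exists>d. T = U * real_diag n d * mat_adjoint U"
  using assms
proof (induction n arbitrary: T)
  case 0
  have "T = 1\<^sub>m 0 * real_diag 0 (\<lambda>_. 0) * mat_adjoint (1\<^sub>m 0)"
    using 0 by (intro eq_matI) auto
  then show ?case by (intro bexI[of _ "1\<^sub>m 0"] exI[of _ "\<lambda>_. 0"] one_in_unitary_mats)
next
  case (Suc m)
  let ?n = "Suc m"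
  note T = Suc.prems(1)
  obtain u k where u: "u \<in> carrier_vec ?n" "(\<Sum>i<?n. (cmod (u $ i))\<^sup>2) = 1" "u $ 0 \<in> \<real>"
    "T *\<^sub>v u = k \<cdot>\<^sub>v u"
    using exists_unit_eigenvector[OF T] by auto
  obtain U where U: "U \<in> unitary_mats ?n" "mat_adjoint U = U" "col U 0 = u"
    using householder_reflection[OF u(1) _ u(2,3)] by auto
  note Uc = unitary_matsD(1)[OF U(1)]
  have UU: "U * U = 1\<^sub>m ?n" using unitary_matsD(3)[OF U(1)] U(2) by simp
  define S where "S = U * (T * U)"
  have TU: "T * U \<in> carrier_mat ?n ?n" using T Uc by simp
  have S: "S \<in> carrier_mat ?n ?n" using TU Uc by (simp add: S_def)
  have Sherm: "mat_adjoint S = S"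
    using T Uc by (simp add: S_def mat_adjoint_mult[OF Uc TU] mat_adjoint_mult[OF T Uc] U(2) Suc.prems(2))
  have TS: "T = U * S * U"
    using T Uc by (simp add: S_def mult_sq_assoc[of _ ?n] mult_sq_carrier[of _ ?n] mult_cancel[OF UU] UU
        del: assoc_mult_mat)
  have col0: "S $$ (i,0) = (if i = 0 then k else 0)" if i: "i < ?n" for i
  proof -
    have "(T * U) $$ (j,0) = k * U $$ (j,0)" if "j < ?n" for j
    proof -
      have "(T * U) $$ (j,0) = (T *\<^sub>v col U 0) $ j" using T Uc that by simp
      also have "\<dots> = k * u $ j" using U(3) u(1,4) that by simp
      also have "u $ j = U $$ (j,0)" using Uc that by (simp flip: U(3))
    finally show ?thesis .
    qed
    then have "S $$ (i,0) = (\<Sum>j<?n. U $$ (i,j) * (k * U $$ (j,0)))"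
      unfolding S_def mat_mult_index[OF Uc TU i zero_less_Suc] by (intro sum.cong) auto
    also have "\<dots> = k * (U * U) $$ (i,0)"
      unfolding mat_mult_index[OF Uc Uc i zero_less_Suc] by (simp add: sum_distrib_left mult_ac del: sum.lessThan_Suc)
    finally show ?thesis using i by (simp add: UU)
  qed
  have adj: "S $$ (i,j) = cnj (S $$ (j,i))" if "i < ?n" "j < ?n" for i j
    using Sherm mat_adjoint_index[of i S j] S that by auto
  have kcnj: "cnj k = k" using adj[of 0 0] col0[of 0] by simp
  then have kreal: "complex_of_real (Re k) = k" by (simp add: complex_eq_iff)
  define R where "R = mat m m (\<lambda>(i,j). S $$ (Suc i, Suc j))"
  have R: "R \<in> carrier_mat m m" by (simp add: R_def)
  have "mat_adjoint R = R" by (rule eq_matI) (auto simp: R_def adj[symmetric])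
  from Suc.IH[OF R this] obtain V d where V: "V \<in> unitary_mats m"
    and RV: "R = V * real_diag m d * mat_adjoint V" by auto
  note Vc = unitary_matsD[OF V]
  define bl where "bl x Y = four_block_mat (mat_diag 1 (\<lambda>_. x)) (0\<^sub>m 1 m) (0\<^sub>m m 1) Y"
    for x :: complex and Y
  have blc: "bl x Y \<in> carrier_mat ?n ?n" if "Y \<in> carrier_mat m m" for x Y
    using four_block_carrier_mat[OF mat_diag_dim that, of 1 "\<lambda>_. x"] by (simp add: bl_def)
  have bl_mult: "bl x Y * bl y Z = bl (x * y) (Y * Z)"
    if "Y \<in> carrier_mat m m" "Z \<in> carrier_mat m m" for x y Y Z
    using that unfolding bl_def
    by (subst mult_four_block_mat[of _ 1 1 _ m _ m _ _ 1 _ m])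
      (auto simp del: One_nat_def simp: right_mult_zero_mat[OF mat_diag_dim] left_mult_zero_mat[OF mat_diag_dim])
  have bl_adj: "mat_adjoint (bl x Y) = bl (cnj x) (mat_adjoint Y)" if "Y \<in> carrier_mat m m" for x Y
    using that by (intro eq_matI) (auto simp: bl_def mat_diag_def)
  have bl_one: "bl 1 (1\<^sub>m m) = 1\<^sub>m ?n"
    by (rule eq_matI) (auto simp: bl_def mat_diag_def)
  have blV: "bl 1 V \<in> unitary_mats ?n"
    using Vc blc by (auto simp: unitary_mats_def bl_adj bl_mult bl_one)
  have "S = bl k R"
  proof (rule eq_matI)
    fix i j assume "i < dim_row (bl k R)" "j < dim_col (bl k R)"
    then have ij: "i < ?n" "j < ?n" using blc[OF R, of k] by auto
    show "S $$ (i,j) = bl k R $$ (i,j)"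
      using ij R col0[of i] col0[of j] adj[of i j] kcnj
      by (cases i; cases j) (auto simp: bl_def mat_diag_def R_def)
  qed (use S blc[OF R, of k] in auto)
  also have "\<dots> = bl 1 V * bl k (real_diag m d) * mat_adjoint (bl 1 V)"
    using Vc by (simp add: RV bl_adj bl_mult)
  also have "bl k (real_diag m d) = real_diag ?n (case_nat (Re k) d)"
    using kreal by (intro eq_matI) (auto simp: bl_def mat_diag_def split: nat.split)
  finally have SV: "S = bl 1 V * real_diag ?n (case_nat (Re k) d) * mat_adjoint (bl 1 V)" .
  have "mat_adjoint (U * bl 1 V) = mat_adjoint (bl 1 V) * U"
    using mat_adjoint_mult[OF Uc unitary_matsD(1)[OF blV]] U(2) by simp
  then have "T = (U * bl 1 V) * real_diag ?n (case_nat (Re k) d) * mat_adjoint (U * bl 1 V)"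
    unfolding TS SV using Uc unitary_matsD(1,2)[OF blV]
    by (simp add: mult_sq_assoc[of _ ?n] mult_sq_carrier[of _ ?n] del: assoc_mult_mat)
  then show ?case using unitary_mats_mult[OF U(1) blV] by blast
qed

section \<open>Uniqueness of square roots with positive spectrum\<close>

lemma char_poly_similar_real_diag:
  assumes "P \<in> carrier_mat n n" "Q \<in> carrier_mat n n" "P * Q = 1\<^sub>m n" "Q * P = 1\<^sub>m n"
  shows "char_poly (P * real_diag n d * Q) = (\<Prod>a\<leftarrow>map (\<lambda>i. complex_of_real (d i)) [0..<n]. [:- a, 1:])"
proof -
  have "similar_mat (P * real_diag n d * Q) (real_diag n d)"
    unfolding similar_mat_def similar_mat_wit_def Let_def using assms
    by (intro exI[of _ P] exI[of _ Q]) auto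
  then have "char_poly (P * real_diag n d * Q) = char_poly (real_diag n d)"
    by (rule char_poly_similar)
  also have "\<dots> = (\<Prod>a\<leftarrow>diag_mat (real_diag n d). [:- a, 1:])"
    by (rule char_poly_upper_triangular[OF mat_diag_dim]) (auto simp: upper_triangular_def mat_diag_def)
  also have "diag_mat (real_diag n d) = map (\<lambda>i. complex_of_real (d i)) [0..<n]"
    by (auto simp: diag_mat_def mat_diag_def)
  finally show ?thesis .
qed

lemma spectrum_similar_real_diag:
  assumes "P \<in> carrier_mat n n" "Q \<in> carrier_mat n n" "P * Q = 1\<^sub>m n" "Q * P = 1\<^sub>m n"
  shows "spectrum (P * real_diag n d * Q) = (\<lambda>i. complex_of_real (d i)) ` {..<n}"
proof -
  have c: "P * real_diag n d * Q \<in> carrier_mat n n"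
    using assms by (intro mult_sq_carrier mat_diag_dim)
  show ?thesis
    unfolding spectrum_def using eigenvalue_root_char_poly[OF c] 
    by (auto simp: char_poly_similar_real_diag[OF assms] poly_prod_list prod_list_zero_iff)
qed

text \<open>If \<open>Z\<close> is upper triangular, the equation \<open>Y X = - X Z\<close> read column by column says that the first
nonzero column of \<open>X\<close> would be an eigenvector of \<open>Y\<close> for the negative of a diagonal entry of \<open>Z\<close>.
A Schur decomposition reduces the general case to this one.\<close>

lemma sylvester_zero:
  fixes X Y Z :: "complex mat"
  assumes Y: "Y \<in> carrier_mat n n" and Z: "Z \<in> carrier_mat n n" and X: "X \<in> carrier_mat n n"
    and eq: "Y * X + X * Z = 0\<^sub>m n n"
    and spec: "\<And>k. k \<in> spectrum Z \<Longrightarrow> - k \<notin> spectrum Y"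
  shows "X = 0\<^sub>m n n"
proof -
  obtain es where es: "char_poly Z = (\<Prod>e\<leftarrow>es. [:- e, 1:])"
    using char_poly_factorized[OF Z] by auto
  obtain B P Q where "schur_decomposition Z es = (B, P, Q)" by (metis prod_cases3)
  from schur_decomposition[OF Z es this]
  have sim: "similar_mat_wit Z B P Q" and tri: "upper_triangular B" and diag: "diag_mat B = es"
    by auto
  from sim Z have B: "B \<in> carrier_mat n n" and P: "P \<in> carrier_mat n n" and Q: "Q \<in> carrier_mat n n"
    and PQ: "P * Q = 1\<^sub>m n" and QP: "Q * P = 1\<^sub>m n" and ZB: "Z = P * B * Q"
    by (auto simp: similar_mat_wit_def Let_def)
  define V where "V = X * P"
  have V: "V \<in> carrier_mat n n" using X P by (simp add: V_def)
  have ZP: "Z * P = P * B"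
    using P Q B by (simp add: ZB mult_sq_assoc[of _ n] mult_sq_carrier[of _ n] QP del: assoc_mult_mat)
  have "Y * V + V * B = Y * (X * P) + X * (Z * P)"
    using X P B by (simp add: V_def ZP)
  also have "\<dots> = (Y * X + X * Z) * P"
    using X Y Z P by (simp add: add_mult_distrib_mat[of _ n n])
  also have "\<dots> = 0\<^sub>m n n" using P by (simp add: eq)
  finally have YV: "Y * V + V * B = 0\<^sub>m n n" .
  have col: "col V j = 0\<^sub>v n" if "j < n" for j
    using that
  proof (induction j rule: less_induct)
    case (less j)
    have zero: "V $$ (i,k) = 0" if "i < n" "k < j" for i k
      using less.IH[OF that(2)] less.prems that V
      by (metis carrier_matD(1,2) index_col index_zero_vec(1) less_trans)
    have "(Y *\<^sub>v col V j) $ i = (- (B $$ (j,j)) \<cdot>\<^sub>v col V j) $ i" if i: "i < n" for i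
    proof -
      have "(V * B) $$ (i,j) = (\<Sum>k<n. V $$ (i,k) * B $$ (k,j))"
        by (rule mat_mult_index[OF V B i less.prems])
      also have "\<dots> = (\<Sum>k<n. if k = j then V $$ (i,j) * B $$ (j,j) else 0)"
      proof (rule sum.cong)
        fix k assume "k \<in> {..<n}"
        then show "V $$ (i,k) * B $$ (k,j) = (if k = j then V $$ (i,j) * B $$ (j,j) else 0)"
          using zero[OF i, of k] upper_triangularD[OF tri, of j k] B by (cases k j rule: linorder_cases) auto
      qed simp
      finally have VB: "(V * B) $$ (i,j) = V $$ (i,j) * B $$ (j,j)" using less.prems by simp
      have "(Y * V) $$ (i,j) + (V * B) $$ (i,j) = 0"
        using arg_cong[OF YV, of "\<lambda>M. M $$ (i,j)"] Y V B i less.prems by simp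
      then have "(Y *\<^sub>v col V j) $ i = - ((V * B) $$ (i,j))"
        using Y V i less.prems by (simp add: eq_neg_iff_add_eq_0)
      then show ?thesis unfolding VB using V i less.prems by simp
    qed
    then have ev: "Y *\<^sub>v col V j = - (B $$ (j,j)) \<cdot>\<^sub>v col V j"
      using Y V by (intro eq_vecI) auto
    show ?case
    proof (rule ccontr)
      assume "col V j \<noteq> 0\<^sub>v n"
      then have "eigenvector Y (col V j) (- (B $$ (j,j)))"
        using ev Y V by (auto simp: eigenvector_def)
      then have "- (B $$ (j,j)) \<in> spectrum Y" by (auto simp: spectrum_def eigenvalue_def)
      moreover have "B $$ (j,j) \<in> set es"
        using B less.prems unfolding diag[symmetric] diag_mat_def by auto
      then have "B $$ (j,j) \<in> spectrum Z"
        unfolding spectrum_def using eigenvalue_root_char_poly[OF Z]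
        by (auto simp: es poly_prod_list prod_list_zero_iff)
      ultimately show False using spec by blast
    qed
  qed
  have "V = 0\<^sub>m n n"
  proof (rule eq_matI)
    fix i j assume "i < dim_row (0\<^sub>m n n :: complex mat)" "j < dim_col (0\<^sub>m n n :: complex mat)"
    then show "V $$ (i,j) = 0\<^sub>m n n $$ (i,j)"
      using col[of j] V by (metis carrier_matD index_col index_zero_mat index_zero_vec(1))
  qed (use V in auto)
  moreover have "X = V * Q" using X P Q by (simp add: V_def PQ)
  ultimately show ?thesis using Q by simp
qed

text \<open>For two roots of the same matrix, \<open>Y (Y - Z) + (Y - Z) Z = Y\<^sup>2 - Z\<^sup>2 = 0\<close>, and positive spectra
exclude \<open>k \<in> spectrum Z\<close> together with \<open>-k \<in> spectrum Y\<close>. This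
identifies the positive definite root as well as the principal root of a product \<open>A B\<close>, which is in
general not Hermitian.\<close>

lemma positive_spectrum_sqrt_unique:
  fixes Y Z :: "complex mat"
  assumes Y: "Y \<in> carrier_mat n n" and Z: "Z \<in> carrier_mat n n" and eq: "Y * Y = Z * Z"
    and "spectrum Y \<subseteq> complex_of_real ` {0<..}" "spectrum Z \<subseteq> complex_of_real ` {0<..}"
  shows "Y = Z"
proof -
  have D: "Y - Z \<in> carrier_mat n n" using minus_carrier_mat[OF Z] by blast
  have YZ: "Y * Z \<in> carrier_mat n n" "Z * Z \<in> carrier_mat n n" using Y Z by auto
  have "Y * (Y - Z) + (Y - Z) * Z = 0\<^sub>m n n"
  proof -
    have "M - N + (N - M) = 0\<^sub>m n n"
      if "M \<in> carrier_mat n n" "N \<in> carrier_mat n n" for M N :: "complex mat"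
      using that by (intro eq_matI) auto
    then show ?thesis
      unfolding mult_minus_distrib_mat[OF Y Y Z] minus_mult_distrib_mat[OF Y Z Z] eq using YZ by blast
  qed
  moreover have "- k \<notin> spectrum Y" if "k \<in> spectrum Z" for k
  proof
    assume "- k \<in> spectrum Y"
    then show False using assms(4,5) \<open>k \<in> spectrum Z\<close> by (auto simp: image_iff complex_eq_iff dest!: subsetD)
  qed
  ultimately have "Y - Z = 0\<^sub>m n n" using sylvester_zero[OF Y Z D] by blast
  then have "Y $$ (i,j) - Z $$ (i,j) = 0" if "i < n" "j < n" for i j
    using that Y Z by (metis carrier_matD index_minus_mat(1) index_zero_mat(1))
  then show ?thesis using Y Z by (intro eq_matI) auto
qed

section \<open>Positive definite matrices, inverses and roots\<close>

lemma posdef_matsD: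
  assumes "P \<in> posdef_mats n"
  shows "P \<in> carrier_mat n n" "mat_adjoint P = P"
    "\<And>v. v \<in> carrier_vec n \<Longrightarrow> v \<noteq> 0\<^sub>v n \<Longrightarrow> 0 < Re ((P *\<^sub>v v) \<bullet>c v)"
  using assms by (auto simp: posdef_mats_def)

lemma posdef_congruence:
  assumes P: "P \<in> posdef_mats n" and X: "X \<in> carrier_mat n n"
    and Y: "Y \<in> carrier_mat n n" "Y * X = 1\<^sub>m n"
  shows "mat_adjoint X * P * X \<in> posdef_mats n"
proof -
  note P = posdef_matsD[OF P]
  have Xa: "mat_adjoint X \<in> carrier_mat n n" using X by simp
  have PX: "P * X \<in> carrier_mat n n" using P(1) X by simp
  have eq: "mat_adjoint X * P * X = mat_adjoint X * (P * X)"
    by (rule mult_sq_assoc[OF Xa P(1) X])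
  have "mat_adjoint (mat_adjoint X * (P * X)) = mat_adjoint X * (P * X)"
    unfolding mat_adjoint_mult[OF Xa PX] mat_adjoint_mult[OF P(1) X] using P(2) mult_sq_assoc[OF Xa P(1) X] by simp
  moreover have "0 < Re (((mat_adjoint X * (P * X)) *\<^sub>v v) \<bullet>c v)"
    if v: "v \<in> carrier_vec n" "v \<noteq> 0\<^sub>v n" for v
  proof -
    have Xv: "X *\<^sub>v v \<in> carrier_vec n" using X v by simp
    have "X *\<^sub>v v \<noteq> 0\<^sub>v n"
    proof
      assume "X *\<^sub>v v = 0\<^sub>v n"
      moreover have "Y *\<^sub>v 0\<^sub>v n = 0\<^sub>v n" using Y(1) by (intro eq_vecI) auto
      ultimately have "(Y * X) *\<^sub>v v = 0\<^sub>v n" using assoc_mult_mat_vec[OF Y(1) X v(1)] by simp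
      then show False using v Y(2) by simp
    qed
    then have "0 < Re ((P *\<^sub>v (X *\<^sub>v v)) \<bullet>c (X *\<^sub>v v))" using P(3) Xv by blast
    also have "(P *\<^sub>v (X *\<^sub>v v)) \<bullet>c (X *\<^sub>v v) = (mat_adjoint X *\<^sub>v (P *\<^sub>v (X *\<^sub>v v))) \<bullet>c v"
      using inner_mat_adjoint[OF Xa, of "P *\<^sub>v (X *\<^sub>v v)" v] P(1) Xv v by simp
    also have "mat_adjoint X *\<^sub>v (P *\<^sub>v (X *\<^sub>v v)) = (mat_adjoint X * (P * X)) *\<^sub>v v"
      using assoc_mult_mat_vec[OF Xa PX v(1)] assoc_mult_mat_vec[OF P(1) X v(1)] by simp
    finally show ?thesis .
  qed
  ultimately show ?thesis unfolding eq posdef_mats_def using Xa PX by simp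
qed

lemma inner_real_diag:
  assumes "v \<in> carrier_vec n"
  shows "(real_diag n d *\<^sub>v v) \<bullet>c v = complex_of_real (\<Sum>i<n. d i * (cmod (v $ i))\<^sup>2)"
proof -
  have "(real_diag n d *\<^sub>v v) $ i = d i * v $ i" if "i < n" for i
  proof -
    have "(real_diag n d *\<^sub>v v) $ i = (\<Sum>j<n. if j = i then d i * v $ i else 0)"
      using that assms
      by (auto simp: mat_diag_def scalar_prod_def lessThan_atLeast0 simp del: sum.delta sum.delta' intro!: sum.cong)
    then show ?thesis using that by simp
  qed
  then show ?thesis using assms
    by (auto simp: scalar_prod_def lessThan_atLeast0 complex_norm_square mat_diag_def mult.assoc
        simp del: of_real_power index_mult_mat_vec intro!: sum.cong)
qed

lemma real_diag_hermitian: "mat_adjoint (real_diag n d) = real_diag n d"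
  by (simp add: mat_adjoint_mat_diag)

lemma real_diag_posdef:
  assumes "\<And>i. i < n \<Longrightarrow> 0 < d i"
  shows "real_diag n d \<in> posdef_mats n"
proof -
  have "0 < (\<Sum>i<n. d i * (cmod (v $ i))\<^sup>2)" if v: "v \<in> carrier_vec n" "v \<noteq> 0\<^sub>v n" for v
  proof -
    obtain i where i: "i < n" "v $ i \<noteq> 0"
      using v by (metis carrier_vecD eq_vecI index_zero_vec)
    show ?thesis
      by (rule sum_pos2[of _ i]) (use i assms in \<open>auto intro!: mult_nonneg_nonneg simp: less_imp_le\<close>)
  qed
  then show ?thesis
    unfolding posdef_mats_def by (auto simp: real_diag_hermitian inner_real_diag)
qed

lemma unitary_conj_real_diag_posdef:
  assumes "U \<in> unitary_mats n" "\<And>i. i < n \<Longrightarrow> 0 < d i"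
  shows "U * real_diag n d * mat_adjoint U \<in> posdef_mats n"
  using posdef_congruence[OF real_diag_posdef[of n d] unitary_matsD(2,1,4)[OF assms(1)]] assms(2)
  by simp

text \<open>The eigenvalues are positive because \<open>U\<^sup>* P U\<close> is again positive definite and its diagonal entries
are values of its quadratic form at basis vectors.\<close>

lemma posdef_spectral_decomposition:
  assumes P: "P \<in> posdef_mats n"
  obtains U d where "U \<in> unitary_mats n" "\<And>i. i < n \<Longrightarrow> 0 < d i"
    "P = U * real_diag n d * mat_adjoint U"
proof -
  note Pc = posdef_matsD[OF P]
  obtain U d where U: "U \<in> unitary_mats n" and PU: "P = U * real_diag n d * mat_adjoint U"
    using hermitian_spectral_decomposition[OF Pc(1,2)] by blast
  note Uc = unitary_matsD[OF U]
  have "mat_adjoint U * P * U = real_diag n d"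
    using Uc by (simp add: PU mult_sq_assoc[of _ n] mult_sq_carrier[of _ n] mult_cancel[OF Uc(3)]
        right_mult_one_mat[OF mat_diag_dim]
        del: assoc_mult_mat)
  then have D: "real_diag n d \<in> posdef_mats n"
    using posdef_congruence[OF P Uc(1,2,3)] by simp
  have "0 < d i" if i: "i < n" for i
  proof -
    have e: "unit_vec n i \<in> carrier_vec n" "unit_vec n i \<noteq> (0\<^sub>v n :: complex vec)"
      using i by (auto dest: arg_cong[of _ _ "\<lambda>v. v $ i"])
    have "(\<Sum>j<n. d j * (cmod (unit_vec n i $ j))\<^sup>2) = (\<Sum>j<n. if j = i then d i else 0)"
      using i by (intro sum.cong) auto
    then show ?thesis using posdef_matsD(3)[OF D e] i by (simp add: inner_real_diag[OF e(1)])
  qed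
  then show ?thesis using that U PU by blast
qed

lemma posdef_spectrum:
  assumes "P \<in> posdef_mats n"
  shows "spectrum P \<subseteq> complex_of_real ` {0<..}"
proof -
  obtain U d where U: "U \<in> unitary_mats n" and d: "\<And>i. i < n \<Longrightarrow> 0 < d i"
    and P: "P = U * real_diag n d * mat_adjoint U"
    using posdef_spectral_decomposition[OF assms] by blast
  show ?thesis using d
    unfolding P spectrum_similar_real_diag[OF unitary_matsD(1,2,4,3)[OF U]] by auto
qed

lemma unitary_conj_mult:
  assumes "U \<in> unitary_mats n" "X \<in> carrier_mat n n" "Y \<in> carrier_mat n n"
  shows "(U * X * mat_adjoint U) * (U * Y * mat_adjoint U) = U * (X * Y) * mat_adjoint U"
  using unitary_matsD[OF assms(1)] assms(2,3)
  by (simp add: mult_sq_assoc[of _ n] mult_sq_carrier[of _ n] mult_cancel[of "mat_adjoint U" U n]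
      del: assoc_mult_mat)

lemma unitary_conj_one:
  assumes "U \<in> unitary_mats n"
  shows "U * 1\<^sub>m n * mat_adjoint U = 1\<^sub>m n"
  using unitary_matsD[OF assms] by simp

lemma real_diag_eq_one:
  assumes "\<And>i. i < n \<Longrightarrow> d i = 1"
  shows "real_diag n d = 1\<^sub>m n"
  using assms by (intro eq_matI) (auto simp: mat_diag_def)

lemma minv_eqI:
  assumes A: "A \<in> carrier_mat n n" and R: "R \<in> carrier_mat n n" and "A * R = 1\<^sub>m n" "R * A = 1\<^sub>m n"
  shows "minv A = R"
proof -
  have "A \<in> Units (ring_mat TYPE(complex) n b)" for b
    using assms by (auto simp: Units_def ring_mat_simps)
  then obtain B where B: "mat_inverse A = Some B" using mat_inverse(1)[OF A] by fastforce
  with mat_inverse(2)[OF A] have AB: "B * A = 1\<^sub>m n" "B \<in> carrier_mat n n" by auto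
  have "B = B * (A * R)" using AB(2) assms(3) by simp
  also have "\<dots> = (B * A) * R" using A AB(2) R by (simp add: assoc_mult_mat[of B n n A n R n])
  also have "\<dots> = R" using AB(1) R by simp
  finally show ?thesis by (simp add: minv_def B)
qed

lemma minv_posdef:
  assumes "P \<in> posdef_mats n"
  shows "minv P \<in> posdef_mats n" "P * minv P = 1\<^sub>m n" "minv P * P = 1\<^sub>m n"
proof -
  obtain U d where U: "U \<in> unitary_mats n" and d: "\<And>i. i < n \<Longrightarrow> 0 < d i"
    and P: "P = U * real_diag n d * mat_adjoint U"
    using posdef_spectral_decomposition[OF assms] by blast
  define R where "R = U * real_diag n (\<lambda>i. 1 / d i) * mat_adjoint U"
  have "real_diag n d * real_diag n (\<lambda>i. 1 / d i) = 1\<^sub>m n" "real_diag n (\<lambda>i. 1 / d i) * real_diag n d = 1\<^sub>m n"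
    unfolding mat_diag_diag using d
    by (auto intro!: eq_matI simp: mat_diag_def less_imp_neq[THEN not_sym])
  then have PR: "P * R = 1\<^sub>m n" "R * P = 1\<^sub>m n"
    using unitary_conj_mult[OF U mat_diag_dim mat_diag_dim] unitary_conj_one[OF U]
    by (simp_all add: P R_def)
  have R: "R \<in> posdef_mats n" unfolding R_def using U d by (intro unitary_conj_real_diag_posdef) auto
  have "minv P = R"
    using minv_eqI[OF posdef_matsD(1)[OF assms] posdef_matsD(1)[OF R] PR] .
  then show "minv P \<in> posdef_mats n" "P * minv P = 1\<^sub>m n" "minv P * P = 1\<^sub>m n"
    using R PR by auto
qed

lemma pd_sqrt_eqI:
  assumes "Q \<in> posdef_mats n" "Q * Q = P"
  shows "pd_sqrt P = Q"
  unfolding pd_sqrt_def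
proof (rule the_equality)
  have n: "dim_row P = n" using posdef_matsD(1)[OF assms(1)] assms(2) by auto
  then show "Q \<in> posdef_mats (dim_row P) \<and> Q * Q = P" using assms by simp
  fix R assume "R \<in> posdef_mats (dim_row P) \<and> R * R = P"
  then have R: "R \<in> posdef_mats n" "R * R = Q * Q" unfolding n assms(2) by auto
  show "R = Q"
    by (rule positive_spectrum_sqrt_unique[OF posdef_matsD(1)[OF R(1)] posdef_matsD(1)[OF assms(1)] R(2)
          posdef_spectrum[OF R(1)] posdef_spectrum[OF assms(1)]])
qed

lemma pd_sqrt_posdef:
  assumes "P \<in> posdef_mats n"
  shows "pd_sqrt P \<in> posdef_mats n" "pd_sqrt P * pd_sqrt P = P"
proof -
  obtain U d where U: "U \<in> unitary_mats n" and d: "\<And>i. i < n \<Longrightarrow> 0 < d i"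
    and P: "P = U * real_diag n d * mat_adjoint U"
    using posdef_spectral_decomposition[OF assms] by blast
  define R where "R = U * real_diag n (\<lambda>i. sqrt (d i)) * mat_adjoint U"
  have R: "R \<in> posdef_mats n" unfolding R_def using U d by (intro unitary_conj_real_diag_posdef) auto
  have "real_diag n (\<lambda>i. sqrt (d i)) * real_diag n (\<lambda>i. sqrt (d i)) = real_diag n d"
    unfolding mat_diag_diag using d
    by (intro eq_matI) (auto simp: mat_diag_def less_imp_le simp flip: of_real_mult)
  then have RR: "R * R = P"
    using unitary_conj_mult[OF U mat_diag_dim mat_diag_dim] by (simp add: P R_def)
  show "pd_sqrt P \<in> posdef_mats n" "pd_sqrt P * pd_sqrt P = P"
    using R RR pd_sqrt_eqI by auto
qed

lemma principal_sqrt_eqI: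
  assumes "Y \<in> carrier_mat n n" "Y * Y = X" "spectrum Y \<subseteq> complex_of_real ` {0<..}"
  shows "principal_sqrt X = Y"
  unfolding principal_sqrt_def
proof (rule the_equality)
  have n: "dim_row X = n" using assms(1,2) by auto
  then show "Y \<in> carrier_mat (dim_row X) (dim_row X) \<and> Y * Y = X \<and> spectrum Y \<subseteq> complex_of_real ` {0<..}"
    using assms by simp
  fix Z assume "Z \<in> carrier_mat (dim_row X) (dim_row X) \<and> Z * Z = X \<and> spectrum Z \<subseteq> complex_of_real ` {0<..}"
  then have Z: "Z \<in> carrier_mat n n" "Z * Z = Y * Y" "spectrum Z \<subseteq> complex_of_real ` {0<..}"
    unfolding n assms(2) by auto
  show "Z = Y"
    by (rule positive_spectrum_sqrt_unique[OF Z(1) assms(1) Z(2,3) assms(3)])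
qed

section \<open>Simultaneous coordinates for a pair of positive definite matrices\<close>

text \<open>This supplies the spectral condition in the description of the principal root: \<open>S\<^sup>-\<^sup>1 C S\<close> need not
be Hermitian, but it is similar to a positive definite matrix.\<close>

lemma similar_posdef_spectrum:
  assumes C: "C \<in> posdef_mats n" and X: "X \<in> carrier_mat n n" "Y \<in> carrier_mat n n"
    "X * Y = 1\<^sub>m n" "Y * X = 1\<^sub>m n"
  shows "spectrum (X * C * Y) \<subseteq> complex_of_real ` {0<..}"
proof -
  obtain V d where V: "V \<in> unitary_mats n" and d: "\<And>i. i < n \<Longrightarrow> 0 < d i"
    and CV: "C = V * real_diag n d * mat_adjoint V"
    using posdef_spectral_decomposition[OF C] by blast
  note Vc = unitary_matsD[OF V]
  note sq = mult_sq_assoc[of _ n] mult_sq_carrier[of _ n]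
  have eq: "X * C * Y = (X * V) * real_diag n d * (mat_adjoint V * Y)"
    using X Vc by (simp add: CV sq del: assoc_mult_mat)
  have "(X * V) * (mat_adjoint V * Y) = 1\<^sub>m n" "(mat_adjoint V * Y) * (X * V) = 1\<^sub>m n"
    using X Vc by (simp_all add: sq mult_cancel[OF Vc(4)] mult_cancel[OF X(4)] del: assoc_mult_mat)
  then have "spectrum (X * C * Y) = (\<lambda>i. complex_of_real (d i)) ` {..<n}"
    unfolding eq using X Vc by (intro spectrum_similar_real_diag mult_sq_carrier) auto
  then show ?thesis using d by auto
qed

text \<open>With \<open>R = (A\<^sup>-\<^sup>1)\<^sup>1\<^sup>/\<^sup>2\<close> and \<open>K\<close> the root of \<open>R\<^sup>-\<^sup>1 B R\<^sup>-\<^sup>1\<close>, the mean is \<open>G = R K R\<close>. Since \<open>R A R = I\<close>,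
\<open>G A G = R K (R A R) K R = R K\<^sup>2 R = B\<close>.\<close>

lemma geometric_mean_riccati:
  assumes A: "A \<in> posdef_mats n" and B: "B \<in> posdef_mats n"
  defines "G \<equiv> geometric_mean (minv A) B"
  shows "G \<in> posdef_mats n" "G * (A * G) = B"
proof -
  define R where "R = pd_sqrt (minv A)"
  define Ri where "Ri = minv R"
  define K where "K = pd_sqrt (Ri * B * Ri)"
  note sq = mult_sq_assoc[of _ n] mult_sq_carrier[of _ n]
  note Ai = minv_posdef[OF A]
  have R: "R \<in> posdef_mats n" "R * R = minv A"
    using pd_sqrt_posdef[OF Ai(1)] by (auto simp: R_def)
  have Ri: "Ri \<in> posdef_mats n" "R * Ri = 1\<^sub>m n" "Ri * R = 1\<^sub>m n"
    using minv_posdef[OF R(1)] by (auto simp: Ri_def)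
  note Rc = posdef_matsD(1)[OF R(1)] and Ric = posdef_matsD(1)[OF Ri(1)]
    and Ac = posdef_matsD(1)[OF A] and Bc = posdef_matsD(1)[OF B]
  have "Ri * B * Ri \<in> posdef_mats n"
    using posdef_congruence[OF B Ric Rc Ri(2)] posdef_matsD(2)[OF Ri(1)] by simp
  then have K: "K \<in> posdef_mats n" "K * K = Ri * B * Ri"
    using pd_sqrt_posdef unfolding K_def by blast+
  note Kc = posdef_matsD(1)[OF K(1)]
  have G: "G = R * K * R" by (simp add: G_def geometric_mean_def R_def K_def Ri_def)
  show "G \<in> posdef_mats n"
    using posdef_congruence[OF K(1) Rc Ric Ri(3)] posdef_matsD(2)[OF R(1)] by (simp add: G)
  have "R * A = Ri * (R * (R * A))"
    using Rc Ac by (simp add: mult_cancel[OF Ri(3) Ric Rc] sq del: assoc_mult_mat)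
  also have "R * (R * A) = 1\<^sub>m n"
    using mult_sq_assoc[OF Rc Rc Ac] Ai(3) R(2) by simp
  finally have RA: "R * A = Ri" using Ric by simp
  have "G * (A * G) = R * (K * ((R * A) * (R * (K * R))))"
    using Rc Kc Ac by (simp add: G sq del: assoc_mult_mat)
  also have "\<dots> = R * ((K * K) * R)"
    using Rc Kc Ric by (simp add: RA mult_cancel[OF Ri(3) Ric Rc] sq del: assoc_mult_mat)
  also have "\<dots> = B"
    using Rc Ric Bc by (simp add: K(2) Ri(3) mult_cancel[OF Ri(2) Rc Ric] sq del: assoc_mult_mat)
  finally show "G * (A * G) = B" .
qed

text \<open>Here \<open>Q diag(s) Q\<^sup>*\<close> is the root \<open>S\<close> of \<open>A\<^sup>-\<^sup>1 # B\<close> and \<open>Q C Q\<^sup>* = S A S\<close>. Diagonalizing \<open>S\<close>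
once and for all turns every later identity between the matrices involved into an identity between
scalar multiples of the entries of \<open>C\<close>.\<close>

theorem spectral_mean_coordinates:
  assumes A: "A \<in> posdef_mats n" and B: "B \<in> posdef_mats n"
  obtains Q s C where "Q \<in> unitary_mats n" "\<And>i. i < n \<Longrightarrow> 0 < s i" "C \<in> posdef_mats n"
    "A = Q * (real_diag n (\<lambda>i. 1 / s i) * C * real_diag n (\<lambda>i. 1 / s i)) * mat_adjoint Q"
    "B = Q * (real_diag n s * C * real_diag n s) * mat_adjoint Q"
    "spectral_geometric_mean A B = Q * C * mat_adjoint Q"
    "principal_sqrt (A * B) = Q * (real_diag n (\<lambda>i. 1 / s i) * C * real_diag n s) * mat_adjoint Q"
    "principal_sqrt (B * A) = Q * (real_diag n s * C * real_diag n (\<lambda>i. 1 / s i)) * mat_adjoint Q"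
proof -
  define G where "G = geometric_mean (minv A) B"
  have G: "G \<in> posdef_mats n" "G * (A * G) = B"
    using geometric_mean_riccati[OF A B] by (auto simp: G_def)
  define S where "S = pd_sqrt G"
  have S: "S \<in> posdef_mats n" "S * S = G" using pd_sqrt_posdef[OF G(1)] by (auto simp: S_def)
  obtain Q s where Q: "Q \<in> unitary_mats n" and s: "\<And>i. i < n \<Longrightarrow> 0 < s i"
    and SQ: "S = Q * real_diag n s * mat_adjoint Q"
    using posdef_spectral_decomposition[OF S(1)] by blast
  note Qc = unitary_matsD[OF Q] and Sc = posdef_matsD(1)[OF S(1)] and Ac = posdef_matsD(1)[OF A]
  define D where "D = real_diag n s"
  define Di where "Di = real_diag n (\<lambda>i. 1 / s i)"
  have Dc: "D \<in> carrier_mat n n" "Di \<in> carrier_mat n n" by (auto simp: D_def Di_def)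
  have DD: "D * Di = 1\<^sub>m n" "Di * D = 1\<^sub>m n"
    unfolding D_def Di_def mat_diag_diag using s
    by (auto intro!: eq_matI simp: mat_diag_def less_imp_neq[THEN not_sym])
  note sq = mult_sq_assoc[of _ n] mult_sq_carrier[of _ n]
  note cancel = mult_cancel[OF Qc(3)] mult_cancel[OF Qc(4)] mult_cancel[OF DD(1) Dc] mult_cancel[OF DD(2) Dc(2,1)]
    DD Qc(3,4)
  define C where "C = mat_adjoint Q * (S * A * S) * Q"
  have "S * A * S \<in> posdef_mats n"
    using posdef_congruence[OF A Sc posdef_matsD(1)[OF minv_posdef(1)[OF S(1)]] minv_posdef(3)[OF S(1)]]
      posdef_matsD(2)[OF S(1)] by simp
  then have C: "C \<in> posdef_mats n"
    unfolding C_def by (rule posdef_congruence[OF _ Qc(1,2,3)])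
  note Cc = posdef_matsD(1)[OF C]
  have nat: "S * A * S = Q * C * mat_adjoint Q"
    using Qc Sc Ac by (simp add: C_def sq cancel del: assoc_mult_mat)
  define T where "T = Q * Di * mat_adjoint Q"
  have Tc: "T \<in> carrier_mat n n" using Qc Dc by (simp add: T_def sq del: assoc_mult_mat)
  have TS: "T * S = 1\<^sub>m n" "S * T = 1\<^sub>m n"
    using Qc Dc by (simp_all add: T_def SQ D_def[symmetric] sq cancel del: assoc_mult_mat)
  have "A = T * (S * A * S) * T"
    using Tc Sc Ac by (simp add: sq TS mult_cancel[OF TS(1)] del: assoc_mult_mat)
  also have "\<dots> = Q * (Di * C * Di) * mat_adjoint Q"
    unfolding nat using Qc Dc Cc by (simp add: T_def sq cancel del: assoc_mult_mat)
  finally have AQ: "A = Q * (Di * C * Di) * mat_adjoint Q" .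
  have "B = S * (S * A * S) * S"
    using Sc Ac by (simp add: G(2)[symmetric] S(2)[symmetric] sq del: assoc_mult_mat)
  also have "\<dots> = Q * (D * C * D) * mat_adjoint Q"
    unfolding nat using Qc Dc Cc by (simp add: SQ D_def[symmetric] sq cancel del: assoc_mult_mat)
  finally have BQ: "B = Q * (D * C * D) * mat_adjoint Q" .
  have "principal_sqrt (A * B) = Q * (Di * C * D) * mat_adjoint Q"
  proof (rule principal_sqrt_eqI[of _ n])
    show "Q * (Di * C * D) * mat_adjoint Q \<in> carrier_mat n n"
      using Qc Dc Cc by (simp add: sq del: assoc_mult_mat)
    show "Q * (Di * C * D) * mat_adjoint Q * (Q * (Di * C * D) * mat_adjoint Q) = A * B"
      using Qc Dc Cc by (simp add: AQ BQ sq cancel del: assoc_mult_mat)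
    have "Q * (Di * C * D) * mat_adjoint Q = (Q * Di) * C * (D * mat_adjoint Q)"
      using Qc Dc Cc by (simp add: sq del: assoc_mult_mat)
    also have "spectrum \<dots> \<subseteq> complex_of_real ` {0<..}"
      using Qc Dc by (intro similar_posdef_spectrum[OF C]) (simp_all add: sq cancel del: assoc_mult_mat)
    finally show "spectrum (Q * (Di * C * D) * mat_adjoint Q) \<subseteq> complex_of_real ` {0<..}" .
  qed
  moreover have "principal_sqrt (B * A) = Q * (D * C * Di) * mat_adjoint Q"
  proof (rule principal_sqrt_eqI[of _ n])
    show "Q * (D * C * Di) * mat_adjoint Q \<in> carrier_mat n n"
      using Qc Dc Cc by (simp add: sq del: assoc_mult_mat)
    show "Q * (D * C * Di) * mat_adjoint Q * (Q * (D * C * Di) * mat_adjoint Q) = B * A"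
      using Qc Dc Cc by (simp add: AQ BQ sq cancel del: assoc_mult_mat)
    have "Q * (D * C * Di) * mat_adjoint Q = (Q * D) * C * (Di * mat_adjoint Q)"
      using Qc Dc Cc by (simp add: sq del: assoc_mult_mat)
    also have "spectrum \<dots> \<subseteq> complex_of_real ` {0<..}"
      using Qc Dc by (intro similar_posdef_spectrum[OF C]) (simp_all add: sq cancel del: assoc_mult_mat)
    finally show "spectrum (Q * (D * C * Di) * mat_adjoint Q) \<subseteq> complex_of_real ` {0<..}" .
  qed
  moreover have "spectral_geometric_mean A B = Q * C * mat_adjoint Q"
    using nat by (simp add: spectral_geometric_mean_def S_def G_def)
  ultimately show ?thesis
    using that Q s C AQ BQ unfolding D_def Di_def by blast
qed

section \<open>Averages of unitary multiples and Ky Fan sums\<close>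

lemma mult_lincomb_mult:
  fixes P X Y R :: "complex mat"
  assumes P: "P \<in> carrier_mat n n" and X: "X \<in> carrier_mat n n" and Y: "Y \<in> carrier_mat n n"
    and R: "R \<in> carrier_mat n n"
  shows "P * (x \<cdot>\<^sub>m X + y \<cdot>\<^sub>m Y) * R = x \<cdot>\<^sub>m (P * X * R) + y \<cdot>\<^sub>m (P * Y * R)"
proof -
  have c: "x \<cdot>\<^sub>m X \<in> carrier_mat n n" "y \<cdot>\<^sub>m Y \<in> carrier_mat n n" "P * X \<in> carrier_mat n n"
    "P * Y \<in> carrier_mat n n" "x \<cdot>\<^sub>m (P * X) \<in> carrier_mat n n" "y \<cdot>\<^sub>m (P * Y) \<in> carrier_mat n n"
    using P X Y by auto
  show ?thesis
    unfolding mult_add_distrib_mat[OF P c(1,2)] mult_smult_distrib[OF P X] mult_smult_distrib[OF P Y]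
      add_mult_distrib_mat[OF c(5,6) R] mult_smult_assoc_mat[OF c(3) R] mult_smult_assoc_mat[OF c(4) R] ..
qed

text \<open>The convex hull of the matrices \<open>U W V\<close> with unitary \<open>U\<close> and \<open>V\<close>. Generating it by binary convex
combinations makes every convex bound on these matrices a two-case induction.\<close>

inductive_set unitary_mixtures :: "nat \<Rightarrow> complex mat \<Rightarrow> complex mat set"
  for n :: nat and W :: "complex mat" where
  unitary_pair: "U \<in> unitary_mats n \<Longrightarrow> V \<in> unitary_mats n \<Longrightarrow> U * W * V \<in> unitary_mixtures n W"
| convex: "X \<in> unitary_mixtures n W \<Longrightarrow> Y \<in> unitary_mixtures n W \<Longrightarrow> 0 \<le> t \<Longrightarrow> t \<le> 1 \<Longrightarrow>
    complex_of_real t \<cdot>\<^sub>m X + complex_of_real (1 - t) \<cdot>\<^sub>m Y \<in> unitary_mixtures n W"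

lemma unitary_mixtures_carrier:
  assumes "X \<in> unitary_mixtures n W" "W \<in> carrier_mat n n"
  shows "X \<in> carrier_mat n n"
  using assms(1)
  by induction (use assms(2) unitary_matsD(1) in \<open>auto intro!: mult_sq_carrier\<close>)

lemma unitary_mixtures_self:
  assumes "W \<in> carrier_mat n n"
  shows "W \<in> unitary_mixtures n W"
  using unitary_pair[OF one_in_unitary_mats one_in_unitary_mats, of n W] assms by simp

lemma unitary_mixtures_conj:
  assumes Q: "Q \<in> unitary_mats n" and W: "W \<in> carrier_mat n n" and "X \<in> unitary_mixtures n W"
  shows "Q * X * mat_adjoint Q \<in> unitary_mixtures n (Q * W * mat_adjoint Q)"
  using assms(3)
proof induction
  case (unitary_pair U V)
  note Qc = unitary_matsD[OF Q] and Uc = unitary_matsD(1)[OF unitary_pair(1)]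
    and Vc = unitary_matsD(1)[OF unitary_pair(2)]
  have "Q * (U * W * V) * mat_adjoint Q =
      (Q * U * mat_adjoint Q) * (Q * W * mat_adjoint Q) * (Q * V * mat_adjoint Q)"
    using Uc Vc W unitary_conj_mult[OF Q mult_sq_carrier[OF Uc W] Vc] unitary_conj_mult[OF Q Uc W] by simp
  moreover have "Q * U * mat_adjoint Q \<in> unitary_mats n" "Q * V * mat_adjoint Q \<in> unitary_mats n"
    by (intro unitary_mats_mult unitary_mats_adjoint Q unitary_pair)+
  ultimately show ?case using unitary_mixtures.unitary_pair by metis
next
  case (convex X Y t)
  note Qc = unitary_matsD[OF Q] and X = unitary_mixtures_carrier[OF convex(1) W]
    and Y = unitary_mixtures_carrier[OF convex(2) W]
  have "Q * (complex_of_real t \<cdot>\<^sub>m X + complex_of_real (1 - t) \<cdot>\<^sub>m Y) * mat_adjoint Q =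
      complex_of_real t \<cdot>\<^sub>m (Q * X * mat_adjoint Q) + complex_of_real (1 - t) \<cdot>\<^sub>m (Q * Y * mat_adjoint Q)"
    by (rule mult_lincomb_mult[OF Qc(1) X Y Qc(2)])
  then show ?case using unitary_mixtures.convex[OF convex(5,6,3,4)] by simp
qed

lemma unitarily_invariant_norm_mixture_le:
  assumes N: "unitarily_invariant_norm n N" and W: "W \<in> carrier_mat n n"
    and "X \<in> unitary_mixtures n W"
  shows "N X \<le> N W"
  using assms(3)
proof induction
  case (unitary_pair U V)
  then show ?case using N W by (simp add: unitarily_invariant_norm_def)
next
  case (convex X Y t)
  note X = unitary_mixtures_carrier[OF convex(1) W] and Y = unitary_mixtures_carrier[OF convex(2) W]
  have "N (complex_of_real t \<cdot>\<^sub>m X + complex_of_real (1 - t) \<cdot>\<^sub>m Y)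
      \<le> N (complex_of_real t \<cdot>\<^sub>m X) + N (complex_of_real (1 - t) \<cdot>\<^sub>m Y)"
    using N X Y unfolding unitarily_invariant_norm_def by (meson smult_carrier_mat)
  also have "\<dots> = cmod (complex_of_real t) * N X + cmod (complex_of_real (1 - t)) * N Y"
    using N X Y unfolding unitarily_invariant_norm_def by metis
  also have "\<dots> = t * N X + (1 - t) * N Y"
    using convex(3,4) by (simp only: norm_of_real abs_of_nonneg diff_ge_0_iff_ge)
  also have "\<dots> \<le> t * N W + (1 - t) * N W"
    using convex by (intro add_mono mult_left_mono) auto
  finally show ?case by (simp add: algebra_simps)
qed

lemma eigvals_dec_spectral:
  assumes "U \<in> unitary_mats n"
  shows "eigvals_dec (U * real_diag n d * mat_adjoint U) = decreasing (map d [0..<n])"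
proof -
  have pr: "proots (\<Prod>a\<leftarrow>as. [:- a, 1:]) = mset as" for as :: "complex list"
  proof (induction as)
    case (Cons a as)
    have "(\<Prod>a\<leftarrow>as. [:- a, 1:]) \<noteq> 0" by (auto simp: prod_list_zero_iff)
    then show ?case using Cons by (simp add: proots_mult del: mult_pCons_left)
  qed simp
  then have "image_mset Re (proots (char_poly (U * real_diag n d * mat_adjoint U))) = mset (map d [0..<n])"
    unfolding char_poly_similar_real_diag[OF unitary_matsD(1,2,4,3)[OF assms]] pr
    by (simp add: image_mset.compositionality comp_def)
  then show ?thesis
    by (simp only: eigvals_dec_def decreasing_def sorted_list_of_multiset_mset)
qed

lemma mset_decreasing [simp]: "mset (decreasing x) = mset x"
  by (simp add: decreasing_def)

lemma length_decreasing [simp]: "length (decreasing x) = length x"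
  by (simp add: decreasing_def)

lemma decreasing_idem [simp]: "decreasing (decreasing x) = decreasing x"
  unfolding decreasing_def by (metis mset_rev mset_sort sorted_list_of_multiset_mset)

lemma decreasing_mono:
  assumes "i \<le> j" "j < length x"
  shows "decreasing x ! j \<le> decreasing x ! i"
  using assms by (auto simp: decreasing_def rev_nth intro!: sorted_nth_mono)

text \<open>Sorting is realized by a permutation \<open>p\<close> of the indices, so that sums over sorted values can be
compared with sums over index sets.\<close>

lemma decreasing_map_permutation:
  obtains p where "bij_betw p {..<n} {..<n}" "\<And>i. i < n \<Longrightarrow> decreasing (map d [0..<n]) ! i = d (p i)"
proof -
  have "mset (decreasing (map d [0..<n])) = mset (map d [0..<n])" by simp
  from permutation_Ex_bij[OF this] obtain p where p: "bij_betw p {..<n} {..<n}"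
    "\<forall>i<n. decreasing (map d [0..<n]) ! i = map d [0..<n] ! p i" by auto
  then have "decreasing (map d [0..<n]) ! i = d (p i)" if "i < n" for i
    using that bij_betwE[OF p(1)] by auto
  then show ?thesis using that p(1) by blast
qed

lemma sum_list_take: "k \<le> length xs \<Longrightarrow> sum_list (take k xs) = (\<Sum>i<k. xs ! i :: real)"
  by (simp add: sum_list_sum_nth lessThan_atLeast0)

lemma top_sum_attained:
  assumes "k \<le> n"
  obtains I where "I \<subseteq> {..<n}" "card I = k" "sum_list (take k (decreasing (map d [0..<n]))) = sum d I"
proof -
  obtain p where p: "bij_betw p {..<n} {..<n}" "\<And>i. i < n \<Longrightarrow> decreasing (map d [0..<n]) ! i = d (p i)"
    using decreasing_map_permutation[of n d] by auto
  have inj: "inj_on p {..<k}" using p(1) assms by (auto simp: bij_betw_def intro: inj_on_subset)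
  show ?thesis
  proof (rule that[of "p ` {..<k}"])
    show "p ` {..<k} \<subseteq> {..<n}" using bij_betwE[OF p(1)] assms by auto
    show "card (p ` {..<k}) = k" using inj by (simp add: card_image)
    show "sum_list (take k (decreasing (map d [0..<n]))) = sum d (p ` {..<k})"
      using assms p(2) by (simp add: sum_list_take sum.reindex[OF inj])
  qed
qed

text \<open>With \<open>\<tau>\<close> the \<open>k\<close>-th largest value and \<open>1\<^sub>k\<close> the indicator of the top \<open>k\<close> positions, the weights \<open>c\<close>
and \<open>1\<^sub>k\<close> have the same total, so \<open>\<Sum> (c - 1\<^sub>k) d = \<Sum> (c - 1\<^sub>k) (d - \<tau>)\<close>, and there every term is
nonpositive: the factors never have the same strict sign, inside or outside the top positions.\<close>

lemma weighted_sum_le_top_sum: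
  assumes k: "1 \<le> k" "k \<le> n" and c: "\<And>j. j < n \<Longrightarrow> 0 \<le> c j" "\<And>j. j < n \<Longrightarrow> c j \<le> 1"
    and sum: "(\<Sum>j<n. c j) = real k"
  shows "(\<Sum>j<n. c j * d j) \<le> sum_list (take k (decreasing (map d [0..<n])))"
proof -
  obtain p where p: "bij_betw p {..<n} {..<n}" "\<And>i. i < n \<Longrightarrow> decreasing (map d [0..<n]) ! i = d (p i)"
    using decreasing_map_permutation[of n d] by auto
  have pn: "p i < n" if "i < n" for i using bij_betwE[OF p(1)] that by auto
  define \<tau> where "\<tau> = d (p (k - 1))"
  have mono: "d (p j) \<le> d (p i)" if "i \<le> j" "j < n" for i j
    using decreasing_mono[of i j "map d [0..<n]"] that p(2)[of i] p(2)[of j] by simp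
  have ind: "(\<Sum>i<n. (if i < k then 1 else 0) * f i) = (\<Sum>i<k. f i)" for f :: "nat \<Rightarrow> real"
  proof -
    have "(\<Sum>i<n. (if i < k then 1 else 0) * f i) = (\<Sum>i\<in>{i \<in> {..<n}. i < k}. f i)"
      by (subst sum.inter_filter) (auto intro: sum.cong)
    also have "{i \<in> {..<n}. i < k} = {..<k}" using k by auto
    finally show ?thesis .
  qed
  have "(\<Sum>i<n. (c (p i) - (if i < k then 1 else 0)) * (d (p i) - \<tau>)) \<le> 0"
  proof (rule sum_nonpos)
    fix i assume i: "i \<in> {..<n}"
    show "(c (p i) - (if i < k then 1 else 0)) * (d (p i) - \<tau>) \<le> 0"
    proof (cases "i < k")
      case True
      then have "\<tau> \<le> d (p i)" using mono[of i "k - 1"] k by (simp add: \<tau>_def)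
      then show ?thesis using True c(2)[OF pn, of i] i by (auto simp: mult_nonpos_nonneg)
    next
      case False
      then have "d (p i) \<le> \<tau>" using mono[of "k - 1" i] i by (simp add: \<tau>_def)
      then show ?thesis using False c(1)[OF pn, of i] i by (auto simp: mult_nonneg_nonpos)
    qed
  qed
  also have "(\<Sum>i<n. (c (p i) - (if i < k then 1 else 0)) * (d (p i) - \<tau>))
      = (\<Sum>i<n. c (p i) * d (p i)) - (\<Sum>i<n. (if i < k then 1 else 0) * d (p i))
        - \<tau> * ((\<Sum>i<n. c (p i)) - (\<Sum>i<n. (if i < k then 1 else 0) * 1))"
    by (simp add: sum_subtractf sum_distrib_left algebra_simps sum.distrib)
  also have "\<dots> = (\<Sum>j<n. c j * d j) - (\<Sum>i<k. d (p i)) - \<tau> * ((\<Sum>j<n. c j) - real k)"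
    unfolding ind sum.reindex_bij_betw[OF p(1), of c] sum.reindex_bij_betw[OF p(1), of "\<lambda>j. c j * d j"] by simp
  finally have "(\<Sum>j<n. c j * d j) \<le> (\<Sum>i<k. d (p i))" using sum by simp
  also have "\<dots> = sum_list (take k (decreasing (map d [0..<n])))"
    using k p(2) by (simp add: sum_list_take)
  finally show ?thesis .
qed

text \<open>Each diagonal entry is \<open>\<Sum>\<^sub>j F\<^sub>i\<^sub>j y\<^sub>j G\<^sub>j\<^sub>i\<close>, and \<open>Re (F\<^sub>i\<^sub>j G\<^sub>j\<^sub>i)\<close> is at most the mean of \<open>|F\<^sub>i\<^sub>j|\<^sup>2\<close> and
\<open>|G\<^sub>j\<^sub>i|\<^sup>2\<close>. These means form a doubly stochastic matrix because rows and columns of unitary matrices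
are unit vectors. Summed over \<open>k\<close> rows it gives weights in the unit interval with total \<open>k\<close>.\<close>

lemma unitary_pair_diag_sum_le:
  assumes F: "F \<in> unitary_mats n" and G: "G \<in> unitary_mats n"
    and y: "\<And>j. j < n \<Longrightarrow> 0 \<le> y j" and I: "I \<subseteq> {..<n}" "card I = k" "1 \<le> k"
  shows "(\<Sum>i\<in>I. Re ((F * real_diag n y * G) $$ (i,i))) \<le> sum_list (take k (decreasing (map y [0..<n])))"
proof -
  note Fc = unitary_matsD(1)[OF F] and Gc = unitary_matsD(1)[OF G]
  have fin: "finite I" using I(1) finite_subset by blast
  have kn: "k \<le> n" using card_mono[OF _ I(1)] I(2) by simp
  define c where "c j = (\<Sum>i\<in>I. ((cmod (F $$ (i,j)))\<^sup>2 + (cmod (G $$ (j,i)))\<^sup>2) / 2)" for j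
  have entry: "Re ((F * real_diag n y * G) $$ (i,i))
      \<le> (\<Sum>j<n. ((cmod (F $$ (i,j)))\<^sup>2 + (cmod (G $$ (j,i)))\<^sup>2) / 2 * y j)" if "i \<in> I" for i
  proof -
    have i: "i < n" using that I(1) by auto
    have "(F * real_diag n y) \<in> carrier_mat n n" using Fc by simp
    then have "(F * real_diag n y * G) $$ (i,i) = (\<Sum>j<n. (F * real_diag n y) $$ (i,j) * G $$ (j,i))"
      using mat_mult_index[OF _ Gc i i] by blast
    also have "\<dots> = (\<Sum>j<n. F $$ (i,j) * G $$ (j,i) * y j)"
      unfolding mat_diag_mult_right[OF Fc] using i by (intro sum.cong) auto
    finally have "Re ((F * real_diag n y * G) $$ (i,i)) = (\<Sum>j<n. Re (F $$ (i,j) * G $$ (j,i)) * y j)"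
      by simp
    also have "\<dots> \<le> (\<Sum>j<n. ((cmod (F $$ (i,j)))\<^sup>2 + (cmod (G $$ (j,i)))\<^sup>2) / 2 * y j)"
    proof (intro sum_mono mult_right_mono)
      fix j
      have "Re (F $$ (i,j) * G $$ (j,i)) \<le> cmod (F $$ (i,j)) * cmod (G $$ (j,i))"
        using complex_Re_le_cmod[of "F $$ (i,j) * G $$ (j,i)"] by (simp only: norm_mult)
      also have "\<dots> \<le> ((cmod (F $$ (i,j)))\<^sup>2 + (cmod (G $$ (j,i)))\<^sup>2) / 2"
        using sum_squares_bound[of "cmod (F $$ (i,j))" "cmod (G $$ (j,i))"] by simp
      finally show "Re (F $$ (i,j) * G $$ (j,i)) \<le> ((cmod (F $$ (i,j)))\<^sup>2 + (cmod (G $$ (j,i)))\<^sup>2) / 2" .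
    qed (use y in auto)
    finally show ?thesis .
  qed
  have "(\<Sum>i\<in>I. Re ((F * real_diag n y * G) $$ (i,i)))
      \<le> (\<Sum>i\<in>I. \<Sum>j<n. ((cmod (F $$ (i,j)))\<^sup>2 + (cmod (G $$ (j,i)))\<^sup>2) / 2 * y j)"
    using entry by (rule sum_mono)
  also have "\<dots> = (\<Sum>j<n. c j * y j)"
    unfolding c_def sum_distrib_right by (rule sum.swap)
  also have "\<dots> \<le> sum_list (take k (decreasing (map y [0..<n])))"
  proof (rule weighted_sum_le_top_sum[OF I(3) kn])
    show "0 \<le> c j" for j by (auto simp: c_def intro!: sum_nonneg)
    show "c j \<le> 1" if j: "j < n" for j
    proof -
      have "c j \<le> (\<Sum>i<n. ((cmod (F $$ (i,j)))\<^sup>2 + (cmod (G $$ (j,i)))\<^sup>2) / 2)"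
        unfolding c_def using I(1) by (intro sum_mono2) auto
      also have "\<dots> = 1"
        using unitary_col_sum[OF F j] unitary_row_sum[OF G j]
        by (simp add: sum.distrib add_divide_distrib flip: sum_divide_distrib)
      finally show ?thesis .
    qed
    have "(\<Sum>j<n. c j) = (\<Sum>i\<in>I. \<Sum>j<n. ((cmod (F $$ (i,j)))\<^sup>2 + (cmod (G $$ (j,i)))\<^sup>2) / 2)"
      unfolding c_def by (rule sum.swap)
    also have "\<dots> = (\<Sum>i\<in>I. 1)"
    proof (rule sum.cong)
      fix i assume "i \<in> I"
      then have i: "i < n" using I(1) by auto
      show "(\<Sum>j<n. ((cmod (F $$ (i,j)))\<^sup>2 + (cmod (G $$ (j,i)))\<^sup>2) / 2) = 1"
        using unitary_row_sum[OF F i] unitary_col_sum[OF G i]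
        by (simp add: sum.distrib add_divide_distrib flip: sum_divide_distrib)
    qed simp
    finally show "(\<Sum>j<n. c j) = real k" using I(2) by simp
  qed
  finally show ?thesis .
qed

lemma unitary_mixture_diag_sum_le:
  assumes Q: "Q \<in> unitary_mats n" and y: "\<And>j. j < n \<Longrightarrow> 0 \<le> y j"
    and W: "W = Q * real_diag n y * mat_adjoint Q"
    and I: "I \<subseteq> {..<n}" "card I = k" "1 \<le> k" and V: "V \<in> unitary_mats n"
    and "X \<in> unitary_mixtures n W"
  shows "(\<Sum>i\<in>I. Re ((mat_adjoint V * X * V) $$ (i,i))) \<le> sum_list (take k (decreasing (map y [0..<n])))"
  using assms(8)
proof induction
  case (unitary_pair U1 U2)
  note Qc = unitary_matsD[OF Q] and Vc = unitary_matsD[OF V]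
    and U1 = unitary_matsD(1)[OF unitary_pair(1)] and U2 = unitary_matsD(1)[OF unitary_pair(2)]
  have "mat_adjoint V * (U1 * W * U2) * V = (mat_adjoint V * U1 * Q) * real_diag n y * (mat_adjoint Q * U2 * V)"
    using Qc Vc U1 U2 by (simp add: W mult_sq_assoc[of _ n] mult_sq_carrier[of _ n] del: assoc_mult_mat)
  then show ?case
    using unitary_pair_diag_sum_le[of "mat_adjoint V * U1 * Q" n "mat_adjoint Q * U2 * V" y I k] y I
    by (simp only: unitary_mats_mult unitary_mats_adjoint Q V unitary_pair)
next
  case (convex X Y t)
  have Wc: "W \<in> carrier_mat n n"
    using unitary_matsD[OF Q] by (simp add: W mult_sq_carrier[of _ n])
  note Vc = unitary_matsD[OF V] and X = unitary_mixtures_carrier[OF convex(1) Wc]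
    and Y = unitary_mixtures_carrier[OF convex(2) Wc]
  let ?X = "mat_adjoint V * X * V" and ?Y = "mat_adjoint V * Y * V"
    and ?s = "sum_list (take k (decreasing (map y [0..<n])))"
  have c: "?X \<in> carrier_mat n n" "?Y \<in> carrier_mat n n"
    using Vc X Y by (auto intro!: mult_sq_carrier)
  have "mat_adjoint V * (complex_of_real t \<cdot>\<^sub>m X + complex_of_real (1 - t) \<cdot>\<^sub>m Y) * V =
      complex_of_real t \<cdot>\<^sub>m ?X + complex_of_real (1 - t) \<cdot>\<^sub>m ?Y"
    by (rule mult_lincomb_mult[OF Vc(2) X Y Vc(1)])
  moreover have lin: "Re ((complex_of_real r \<cdot>\<^sub>m M + complex_of_real s \<cdot>\<^sub>m N) $$ (i,i))
      = r * Re (M $$ (i,i)) + s * Re (N $$ (i,i))"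
    if "M \<in> carrier_mat n n" "N \<in> carrier_mat n n" "i \<in> I" for M N r s i
    using that I(1) by auto
  ultimately have "(\<Sum>i\<in>I. Re ((mat_adjoint V * (complex_of_real t \<cdot>\<^sub>m X + complex_of_real (1 - t) \<cdot>\<^sub>m Y) * V) $$ (i,i)))
      = t * (\<Sum>i\<in>I. Re (?X $$ (i,i))) + (1 - t) * (\<Sum>i\<in>I. Re (?Y $$ (i,i)))"
    using lin[OF c] by (simp add: sum.distrib sum_distrib_left del: index_mult_mat(1) assoc_mult_mat of_real_diff)
  also have "\<dots> \<le> t * ?s + (1 - t) * ?s"
    using convex by (intro add_mono mult_left_mono) auto
  finally show ?case by (simp add: algebra_simps)
qed

text \<open>In an orthonormal eigenbasis \<open>V\<close> of \<open>H\<close>, a sum of \<open>k\<close> eigenvalues is a sum of \<open>k\<close> diagonal entries of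
\<open>V\<^sup>* H V\<close>, which the preceding estimate bounds.\<close>

theorem unitary_mixture_weakly_majorized:
  assumes W: "W \<in> posdef_mats n" and H: "H \<in> unitary_mixtures n W" "mat_adjoint H = H"
  shows "eigvals_dec H \<prec>\<^sub>w eigvals_dec W"
proof -
  obtain Q y where Q: "Q \<in> unitary_mats n" and y: "\<And>i. i < n \<Longrightarrow> 0 < y i"
    and WQ: "W = Q * real_diag n y * mat_adjoint Q"
    using posdef_spectral_decomposition[OF W] by blast
  note Hc = unitary_mixtures_carrier[OF H(1) posdef_matsD(1)[OF W]]
  obtain V x where V: "V \<in> unitary_mats n" and HV: "H = V * real_diag n x * mat_adjoint V"
    using hermitian_spectral_decomposition[OF Hc H(2)] by blast
  note Vc = unitary_matsD[OF V]
  have VHV: "mat_adjoint V * H * V = real_diag n x"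
    using Vc by (simp add: HV mult_sq_assoc[of _ n] mult_sq_carrier[of _ n] mult_cancel[OF Vc(3)]
        right_mult_one_mat[OF mat_diag_dim] del: assoc_mult_mat)
  have eig: "eigvals_dec H = decreasing (map x [0..<n])" "eigvals_dec W = decreasing (map y [0..<n])"
    unfolding HV WQ by (rule eigvals_dec_spectral; fact)+
  have "sum_list (take k (decreasing (map x [0..<n]))) \<le> sum_list (take k (decreasing (map y [0..<n])))"
    if k: "1 \<le> k" "k \<le> n" for k
  proof -
    obtain I where I: "I \<subseteq> {..<n}" "card I = k"
      and s: "sum_list (take k (decreasing (map x [0..<n]))) = sum x I"
      using top_sum_attained[OF k(2)] by blast
    have "sum x I = (\<Sum>i\<in>I. Re ((mat_adjoint V * H * V) $$ (i,i)))"
      unfolding VHV using I(1) by (intro sum.cong) (auto simp: mat_diag_def)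
    also have "\<dots> \<le> sum_list (take k (decreasing (map y [0..<n])))"
      using unitary_mixture_diag_sum_le[OF Q _ WQ I k(1) V H(1)] y less_imp_le by blast
    finally show ?thesis using s by simp
  qed
  then show ?thesis unfolding eig weakly_majorized_def by auto
qed

section \<open>The two means in coordinates\<close>

lemma diag_mult_diag_index:
  assumes "M \<in> carrier_mat n n" "i < n" "j < n"
  shows "(mat_diag n f * M * mat_diag n g) $$ (i,j) = f i * M $$ (i,j) * g j"
  using assms by (simp add: mat_diag_mult_left[OF assms(1)] mat_diag_mult_right[of _ n])

lemma diag_mult_diag_carrier:
  "M \<in> carrier_mat n n \<Longrightarrow> mat_diag n f * M * mat_diag n g \<in> carrier_mat n n"
  by (intro mult_sq_carrier mat_diag_dim)

lemma lincomb3_index: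
  assumes "X \<in> carrier_mat n n" "Y \<in> carrier_mat n n" "Z \<in> carrier_mat n n" "i < n" "j < n"
  shows "(x \<cdot>\<^sub>m X + y \<cdot>\<^sub>m Y + z \<cdot>\<^sub>m Z) $$ (i,j) = x * X $$ (i,j) + y * Y $$ (i,j) + z * Z $$ (i,j)"
  using assms by simp

lemma conj_add:
  fixes P X Y R :: "complex mat"
  assumes "P \<in> carrier_mat n n" "X \<in> carrier_mat n n" "Y \<in> carrier_mat n n" "R \<in> carrier_mat n n"
  shows "P * X * R + P * Y * R = P * (X + Y) * R"
proof -
  have "1 \<cdot>\<^sub>m Z = Z" for Z :: "complex mat" by (rule eq_matI) auto
  then show ?thesis using mult_lincomb_mult[OF assms, of 1 1] by metis
qed

lemma conj_smult:
  fixes P X R :: "complex mat"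
  assumes "P \<in> carrier_mat n n" "X \<in> carrier_mat n n" "R \<in> carrier_mat n n"
  shows "x \<cdot>\<^sub>m (P * X * R) = P * (x \<cdot>\<^sub>m X) * R"
  using mult_smult_distrib[OF assms(1,2), of x] mult_smult_assoc_mat[OF mult_sq_carrier[OF assms(1,2)] assms(3), of x]
  by simp

lemma positive_weight:
  assumes "0 < (s :: real)" "0 \<le> a" "0 \<le> b" "0 < a \<or> 0 < b"
  shows "0 < a / s + b * s"
  using assms
  by (metis add_nonneg_pos add_pos_nonneg divide_nonneg_pos divide_pos_pos less_imp_le
      mult_nonneg_nonneg mult_pos_pos)

text \<open>The averaging formula, entry by entry. With \<open>x\<^sub>i = a / s\<^sub>i\<close> and \<open>y\<^sub>i = b s\<^sub>i\<close>, whose product is \<open>a b\<close>, the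
entries of the two matrices are \<open>x\<^sub>i x\<^sub>j + y\<^sub>i y\<^sub>j + c\<close> and \<open>(x\<^sub>i + y\<^sub>i) (x\<^sub>j + y\<^sub>j)\<close> times \<open>C\<^sub>i\<^sub>j\<close>. The
numbers \<open>e\<^sub>i = (x\<^sub>i - y\<^sub>i + 2 \<i> sqrt (a b)) / (x\<^sub>i + y\<^sub>i)\<close> have modulus one. Multiplied by
\<open>(x\<^sub>i + y\<^sub>i) (x\<^sub>j + y\<^sub>j)\<close>, the real parts of \<open>e\<^sub>i cnj e\<^sub>j\<close> and \<open>e\<^sub>i e\<^sub>j\<close> are
\<open>(x\<^sub>i - y\<^sub>i) (x\<^sub>j - y\<^sub>j) + 4 a b\<close> and \<open>(x\<^sub>i - y\<^sub>i) (x\<^sub>j - y\<^sub>j) - 4 a b\<close>; averaging them with weights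
\<open>t\<close> and \<open>1 - t\<close> adjusts the multiple of \<open>C\<close>.\<close>

lemma diagonal_weights_mixture:
  fixes C :: "complex mat"
  assumes C: "C \<in> carrier_mat n n" and s: "\<And>i. i < n \<Longrightarrow> 0 < s i"
    and a: "0 \<le> a" and b: "0 \<le> b" and ab: "0 < a \<or> 0 < b" and c: "0 \<le> c" "c \<le> 2 * a * b"
  shows "complex_of_real (a\<^sup>2) \<cdot>\<^sub>m (real_diag n (\<lambda>i. 1 / s i) * C * real_diag n (\<lambda>i. 1 / s i))
      + complex_of_real (b\<^sup>2) \<cdot>\<^sub>m (real_diag n s * C * real_diag n s) + complex_of_real c \<cdot>\<^sub>m C
    \<in> unitary_mixtures n (real_diag n (\<lambda>i. a / s i + b * s i) * C * real_diag n (\<lambda>i. a / s i + b * s i))"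
    (is "?H \<in> _")
proof -
  define x where "x i = a / s i" for i
  define y where "y i = b * s i" for i
  define r where "r = 2 * sqrt (a * b)"
  have r2: "r\<^sup>2 = 4 * (a * b)" using a b by (simp add: r_def)
  have xy: "x i * y i = a * b" if "i < n" for i using s[OF that] by (simp add: x_def y_def)
  have L: "0 < x i + y i" if "i < n" for i
    unfolding x_def y_def by (rule positive_weight[OF s[OF that] a b ab])
  define f where "f i = Complex (x i - y i) r" for i
  define e where "e i = f i / complex_of_real (x i + y i)" for i
  have f2: "(x i - y i)\<^sup>2 + r\<^sup>2 = (x i + y i)\<^sup>2" if "i < n" for i
    using xy[OF that] unfolding r2 by (simp add: power2_eq_square algebra_simps)
  have "cmod (e i) = 1" if "i < n" for i
  proof -
    have "cmod (f i) = x i + y i"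
      using L[OF that] by (simp add: f_def cmod_def f2[OF that])
    then show ?thesis using L[OF that] by (simp add: e_def norm_divide del: of_real_add)
  qed
  then have E: "mat_diag n e \<in> unitary_mats n" "mat_diag n (\<lambda>i. cnj (e i)) \<in> unitary_mats n"
    by (auto intro!: mat_diag_in_unitary_mats)
  have eL: "e i * complex_of_real (x i + y i) = f i"
    "cnj (e i) * complex_of_real (x i + y i) = cnj (f i)" if "i < n" for i
    using L[OF that] by (auto simp: e_def simp del: of_real_add)
  define W where "W = real_diag n (\<lambda>i. a / s i + b * s i) * C * real_diag n (\<lambda>i. a / s i + b * s i)"
  have Wc: "W \<in> carrier_mat n n" unfolding W_def using C by (intro mult_sq_carrier mat_diag_dim)
  have Wx: "W $$ (i,j) = complex_of_real (x i + y i) * C $$ (i,j) * complex_of_real (x j + y j)"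
    if "i < n" "j < n" for i j
    unfolding W_def diag_mult_diag_index[OF C that] by (simp add: x_def y_def)
  define M where "M g h = mat_diag n g * W * mat_diag n h" for g h
  have Mc: "M g h \<in> carrier_mat n n" for g h
    unfolding M_def using Wc by (intro mult_sq_carrier mat_diag_dim)
  have Md: "dim_row (M g h) = n" "dim_col (M g h) = n" for g h
    using Mc[of g h] by auto
  have Mx: "M g h $$ (i,j) = (g i * complex_of_real (x i + y i)) * (h j * complex_of_real (x j + y j)) * C $$ (i,j)"
    if "i < n" "j < n" for g h i j
    unfolding M_def diag_mult_diag_index[OF Wc that] Wx[OF that] by (simp add: mult_ac)
  have Mm: "M g h \<in> unitary_mixtures n W"
    if "mat_diag n g \<in> unitary_mats n" "mat_diag n h \<in> unitary_mats n" for g h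
    unfolding M_def using that by (rule unitary_mixtures.unitary_pair)
  let ?e = "e" and ?e' = "\<lambda>i. cnj (e i)"
  \<comment> \<open>The weight is chosen so that \<open>(2 t - 1) 2 a b = c\<close>. If \<open>a b = 0\<close> then \<open>c = 0\<close>, and division by
    zero gives \<open>t = 1/2\<close>, which still satisfies the equation.\<close>
  define t where "t = (1 + c / (2 * a * b)) / 2"
  have t: "0 \<le> t" "t \<le> 1" 
    using a b c mult_nonneg_nonneg[OF a b] by (auto simp: t_def divide_le_eq_1 mult.assoc less_le)
  have tc: "(2 * t - 1) * (2 * (a * b)) = c"
    using c by (cases "a * b = 0") (auto simp: t_def field_simps)
  let ?mix = "\<lambda>t X Y. complex_of_real t \<cdot>\<^sub>m X + complex_of_real (1 - t) \<cdot>\<^sub>m Y"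
  have "?mix (1/2) W (?mix t (?mix (1/2) (M ?e ?e') (M ?e' ?e)) (?mix (1/2) (M ?e ?e) (M ?e' ?e')))
      \<in> unitary_mixtures n W"
    by (intro unitary_mixtures.convex[of _ n W] unitary_mixtures_self[OF Wc] Mm E t) simp_all
  also have "?mix (1/2) W (?mix t (?mix (1/2) (M ?e ?e') (M ?e' ?e)) (?mix (1/2) (M ?e ?e) (M ?e' ?e'))) = ?H"
    (is "?K = _")
  proof (rule eq_matI)
    fix i j assume "i < dim_row ?H" "j < dim_col ?H"
    then have ij: "i < n" "j < n" using C by auto
    have "?K $$ (i,j) = complex_of_real (1/2) * W $$ (i,j) + complex_of_real (1 - 1/2) *
       (complex_of_real t * (complex_of_real (1/2) * M ?e ?e' $$ (i,j) + complex_of_real (1 - 1/2) * M ?e' ?e $$ (i,j))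
       + complex_of_real (1 - t) * (complex_of_real (1/2) * M ?e ?e $$ (i,j) + complex_of_real (1 - 1/2) * M ?e' ?e' $$ (i,j)))"
      using ij Wc by (auto simp: Md simp del: index_mult_mat(1) assoc_mult_mat of_real_diff)
    also have "\<dots> = ((complex_of_real (x i + y i) * complex_of_real (x j + y j)
       + (complex_of_real t * (f i * cnj (f j) + cnj (f i) * f j)
       + complex_of_real (1 - t) * (f i * f j + cnj (f i) * cnj (f j))) / 2) / 2) * C $$ (i,j)"
      unfolding Mx[OF ij] Wx[OF ij] eL[OF ij(1)] eL[OF ij(2)] by (simp add: field_simps)
    also have "(complex_of_real (x i + y i) * complex_of_real (x j + y j)
       + (complex_of_real t * (f i * cnj (f j) + cnj (f i) * f j)
       + complex_of_real (1 - t) * (f i * f j + cnj (f i) * cnj (f j))) / 2) / 2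
       = complex_of_real (((x i + y i) * (x j + y j) + (x i - y i) * (x j - y j) + (2 * t - 1) * r\<^sup>2) / 2)"
      by (simp add: complex_eq_iff f_def power2_eq_square field_simps)
    also have "((x i + y i) * (x j + y j) + (x i - y i) * (x j - y j) + (2 * t - 1) * r\<^sup>2) / 2
       = x i * x j + y i * y j + (2 * t - 1) * (2 * (a * b))"
      unfolding r2 by (simp add: field_simps)
    also have "\<dots> = a\<^sup>2 * (1 / s i * (1 / s j)) + b\<^sup>2 * (s i * s j) + c"
      unfolding tc by (simp add: x_def y_def power2_eq_square)
    also have "complex_of_real \<dots> * C $$ (i,j) = ?H $$ (i,j)"
      unfolding lincomb3_index[OF diag_mult_diag_carrier[OF C] diag_mult_diag_carrier[OF C] C ij]
        diag_mult_diag_index[OF C ij] by (simp add: algebra_simps)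
    finally show "?K $$ (i,j) = ?H $$ (i,j)" .
  qed (use C Md in auto)
  finally show ?thesis unfolding W_def .
qed

lemma sum_diag_mult_commute:
  assumes "(A :: complex mat) \<in> carrier_mat n n" "B \<in> carrier_mat n n"
  shows "(\<Sum>i<n. (A * B) $$ (i,i)) = (\<Sum>i<n. (B * A) $$ (i,i))"
proof -
  have "(\<Sum>i<n. (A * B) $$ (i,i)) = (\<Sum>i<n. \<Sum>k<n. A $$ (i,k) * B $$ (k,i))"
    using mat_mult_index[OF assms] by (intro sum.cong) auto
  also have "\<dots> = (\<Sum>k<n. \<Sum>i<n. B $$ (k,i) * A $$ (i,k))"
    by (subst sum.swap) (simp add: mult.commute)
  also have "\<dots> = (\<Sum>i<n. (B * A) $$ (i,i))"
    using mat_mult_index[OF assms(2,1)] by (intro sum.cong) auto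
  finally show ?thesis .
qed

lemma sum_diag_unitary_conj:
  assumes U: "U \<in> unitary_mats n" and X: "X \<in> carrier_mat n n"
  shows "(\<Sum>i<n. (U * X * mat_adjoint U) $$ (i,i)) = (\<Sum>i<n. X $$ (i,i))"
proof -
  note Uc = unitary_matsD[OF U]
  have "mat_adjoint U * (U * X) = X" by (rule mult_cancel[OF Uc(3,2,1) X])
  then show ?thesis
    using sum_diag_mult_commute[OF mult_sq_carrier[OF Uc(1) X] Uc(2)] by simp
qed

lemma sum_list_eigvals_dec:
  assumes T: "T \<in> carrier_mat n n" "mat_adjoint T = T"
  shows "sum_list (eigvals_dec T) = (\<Sum>i<n. Re (T $$ (i,i)))"
proof -
  obtain U d where U: "U \<in> unitary_mats n" and TU: "T = U * real_diag n d * mat_adjoint U"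
    using hermitian_spectral_decomposition[OF T] by blast
  have "sum_list (eigvals_dec T) = sum_list (map d [0..<n])"
    unfolding TU eigvals_dec_spectral[OF U]
    by (metis mset_decreasing sum_mset_sum_list)
  also have "\<dots> = (\<Sum>i<n. d i)" by (simp add: interv_sum_list_conv_sum_set_nat lessThan_atLeast0)
  also have "\<dots> = Re (\<Sum>i<n. real_diag n d $$ (i,i))" by (simp add: mat_diag_def)
  also have "(\<Sum>i<n. real_diag n d $$ (i,i)) = (\<Sum>i<n. T $$ (i,i))"
    unfolding TU by (rule sum_diag_unitary_conj[OF U mat_diag_dim, symmetric])
  finally show ?thesis by simp
qed

text \<open>The four summands of \<open>W\<close> factor as \<open>(a / s\<^sub>i + b s\<^sub>i) C\<^sub>i\<^sub>j (a / s\<^sub>j + b s\<^sub>j)\<close>; the cross terms are exactly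
the contributions of the two principal roots. The coordinates do not depend on the coefficients.\<close>

lemma H_mat_W_mat_coordinates:
  assumes A: "A \<in> posdef_mats n" and B: "B \<in> posdef_mats n"
  obtains Q s C where "Q \<in> unitary_mats n" "\<And>i. i < n \<Longrightarrow> 0 < s i" "C \<in> posdef_mats n"
    "\<And>a b c. H_mat c a b A B = Q *
      (complex_of_real (a\<^sup>2) \<cdot>\<^sub>m (real_diag n (\<lambda>i. 1 / s i) * C * real_diag n (\<lambda>i. 1 / s i))
      + complex_of_real (b\<^sup>2) \<cdot>\<^sub>m (real_diag n s * C * real_diag n s) + complex_of_real c \<cdot>\<^sub>m C) * mat_adjoint Q"
    "\<And>a b. W_mat a b A B = Q *
      (real_diag n (\<lambda>i. a / s i + b * s i) * C * real_diag n (\<lambda>i. a / s i + b * s i)) * mat_adjoint Q"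
proof -
  obtain Q s C where Q: "Q \<in> unitary_mats n" and s: "\<And>i. i < n \<Longrightarrow> 0 < s i" and C: "C \<in> posdef_mats n"
    and AQ: "A = Q * (real_diag n (\<lambda>i. 1 / s i) * C * real_diag n (\<lambda>i. 1 / s i)) * mat_adjoint Q"
    and BQ: "B = Q * (real_diag n s * C * real_diag n s) * mat_adjoint Q"
    and nat: "spectral_geometric_mean A B = Q * C * mat_adjoint Q"
    and AB: "principal_sqrt (A * B) = Q * (real_diag n (\<lambda>i. 1 / s i) * C * real_diag n s) * mat_adjoint Q"
    and BA: "principal_sqrt (B * A) = Q * (real_diag n s * C * real_diag n (\<lambda>i. 1 / s i)) * mat_adjoint Q"
    using spectral_mean_coordinates[OF A B] by metis
  note Qc = unitary_matsD(1,2)[OF Q] and Cc = posdef_matsD(1)[OF C]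
  note c = diag_mult_diag_carrier[OF Cc]
  have conj: "P + R = Q * (X + Y) * mat_adjoint Q"
    if "P = Q * X * mat_adjoint Q" "R = Q * Y * mat_adjoint Q" "X \<in> carrier_mat n n" "Y \<in> carrier_mat n n"
    for P R X Y
    using conj_add[OF Qc(1) that(3,4) Qc(2)] that(1,2) by simp
  have conj': "z \<cdot>\<^sub>m P = Q * (z \<cdot>\<^sub>m X) * mat_adjoint Q"
    if "P = Q * X * mat_adjoint Q" "X \<in> carrier_mat n n" for P X z
    using conj_smult[OF Qc(1) that(2) Qc(2)] that(1) by simp
  have "H_mat c a b A B = Q *
      (complex_of_real (a\<^sup>2) \<cdot>\<^sub>m (real_diag n (\<lambda>i. 1 / s i) * C * real_diag n (\<lambda>i. 1 / s i))
      + complex_of_real (b\<^sup>2) \<cdot>\<^sub>m (real_diag n s * C * real_diag n s) + complex_of_real c \<cdot>\<^sub>m C) * mat_adjoint Q"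
    for a b c
    unfolding H_mat_def
    by (intro conj conj' AQ BQ nat add_carrier_mat smult_carrier_mat c Cc)
  moreover have "W_mat a b A B = Q *
      (real_diag n (\<lambda>i. a / s i + b * s i) * C * real_diag n (\<lambda>i. a / s i + b * s i)) * mat_adjoint Q"
    for a b
  proof -
    let ?di = "real_diag n (\<lambda>i. 1 / s i)" and ?d = "real_diag n s"
    have "W_mat a b A B = Q * (complex_of_real (a\<^sup>2) \<cdot>\<^sub>m (?di * C * ?di) + complex_of_real (b\<^sup>2) \<cdot>\<^sub>m (?d * C * ?d)
      + complex_of_real (a * b) \<cdot>\<^sub>m (?di * C * ?d + ?d * C * ?di)) * mat_adjoint Q"
      unfolding W_mat_def
      by (intro conj conj' AQ BQ AB BA add_carrier_mat smult_carrier_mat c Cc)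
    also have "complex_of_real (a\<^sup>2) \<cdot>\<^sub>m (?di * C * ?di) + complex_of_real (b\<^sup>2) \<cdot>\<^sub>m (?d * C * ?d)
      + complex_of_real (a * b) \<cdot>\<^sub>m (?di * C * ?d + ?d * C * ?di)
      = real_diag n (\<lambda>i. a / s i + b * s i) * C * real_diag n (\<lambda>i. a / s i + b * s i)" (is "?l = ?r")
    proof (rule eq_matI)
      fix i j assume "i < dim_row ?r" "j < dim_col ?r"
      then have ij: "i < n" "j < n" by (auto simp: mat_diag_def)
      have add: "(?di * C * ?d + ?d * C * ?di) $$ (i,j) = (?di * C * ?d) $$ (i,j) + (?d * C * ?di) $$ (i,j)"
        using ij by (intro index_add_mat(1)) (auto simp: mat_diag_def)
      have "?l $$ (i,j) = complex_of_real (a\<^sup>2) * (?di * C * ?di) $$ (i,j)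
        + complex_of_real (b\<^sup>2) * (?d * C * ?d) $$ (i,j)
        + complex_of_real (a * b) * (?di * C * ?d + ?d * C * ?di) $$ (i,j)"
        by (intro lincomb3_index[where n = n] add_carrier_mat c ij)
      also have "\<dots> = ?r $$ (i,j)"
        unfolding add diag_mult_diag_index[OF Cc ij]
        by (simp add: algebra_simps power2_eq_square)
      finally show "?l $$ (i,j) = ?r $$ (i,j)" .
    qed (use c Cc in \<open>auto simp: mat_diag_def\<close>)
    finally show ?thesis .
  qed
  ultimately show ?thesis using that Q s C by blast
qed

section \<open>Majorization, norms and sharpness\<close>

lemma weakly_majorized_refl: "x \<prec>\<^sub>w x"
  by (simp add: weakly_majorized_def)

text \<open>If one of \<open>a\<close>, \<open>b\<close> is positive then \<open>W\<close> is positive definite and the averaging formula applies. If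
both vanish, the weights \<open>a / s + b s\<close> vanish too and the formula breaks down, but then both
matrices are zero. For \<open>c = 2 a b\<close> the equality of sums is an equality of traces, since
\<open>a\<^sup>2 / s\<^sup>2 + b\<^sup>2 s\<^sup>2 + 2 a b = (a / s + b s)\<^sup>2\<close> makes the diagonals equal.\<close>

lemma H_mat_compared_with_W_mat:
  assumes A: "A \<in> posdef_mats n" and B: "B \<in> posdef_mats n"
    and a: "0 \<le> a" and b: "0 \<le> b" and c: "0 \<le> c" "c \<le> 2 * a * b"
  shows "H_mat c a b A B \<in> unitary_mixtures n (W_mat a b A B)"
    "W_mat a b A B \<in> carrier_mat n n"
    "eigvals_dec (H_mat c a b A B) \<prec>\<^sub>w eigvals_dec (W_mat a b A B)"
    "c = 2 * a * b \<Longrightarrow> sum_list (eigvals_dec (H_mat c a b A B)) = sum_list (eigvals_dec (W_mat a b A B))"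
proof -
  obtain Q s C where Q: "Q \<in> unitary_mats n" and s: "\<And>i. i < n \<Longrightarrow> 0 < s i" and C: "C \<in> posdef_mats n"
    and H: "\<And>a b c. H_mat c a b A B = Q *
      (complex_of_real (a\<^sup>2) \<cdot>\<^sub>m (real_diag n (\<lambda>i. 1 / s i) * C * real_diag n (\<lambda>i. 1 / s i))
      + complex_of_real (b\<^sup>2) \<cdot>\<^sub>m (real_diag n s * C * real_diag n s) + complex_of_real c \<cdot>\<^sub>m C) * mat_adjoint Q"
    and W: "\<And>a b. W_mat a b A B = Q *
      (real_diag n (\<lambda>i. a / s i + b * s i) * C * real_diag n (\<lambda>i. a / s i + b * s i)) * mat_adjoint Q"
    by (rule H_mat_W_mat_coordinates[OF A B], rule that)
  note Qc = unitary_matsD[OF Q] and Cc = posdef_matsD(1)[OF C]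
  define H' where "H' = complex_of_real (a\<^sup>2) \<cdot>\<^sub>m (real_diag n (\<lambda>i. 1 / s i) * C * real_diag n (\<lambda>i. 1 / s i))
      + complex_of_real (b\<^sup>2) \<cdot>\<^sub>m (real_diag n s * C * real_diag n s) + complex_of_real c \<cdot>\<^sub>m C"
  define W' where "W' = real_diag n (\<lambda>i. a / s i + b * s i) * C * real_diag n (\<lambda>i. a / s i + b * s i)"
  have HQ: "H_mat c a b A B = Q * H' * mat_adjoint Q" by (simp add: H H'_def)
  have WQ: "W_mat a b A B = Q * W' * mat_adjoint Q" by (simp add: W W'_def)
  note dCd = diag_mult_diag_carrier[OF Cc]
  have H'c: "H' \<in> carrier_mat n n" unfolding H'_def by (intro add_carrier_mat smult_carrier_mat dCd Cc)
  have W'c: "W' \<in> carrier_mat n n" unfolding W'_def by (rule dCd)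
  have H'x: "H' $$ (i,j) = complex_of_real (a\<^sup>2 / (s i * s j) + b\<^sup>2 * (s i * s j) + c) * C $$ (i,j)"
    if "i < n" "j < n" for i j
    unfolding H'_def lincomb3_index[OF dCd dCd Cc that] diag_mult_diag_index[OF Cc that]
    by (simp add: algebra_simps)
  have W'x: "W' $$ (i,j) = complex_of_real ((a / s i + b * s i) * (a / s j + b * s j)) * C $$ (i,j)"
    if "i < n" "j < n" for i j
    unfolding W'_def diag_mult_diag_index[OF Cc that] by simp
  have Cx: "cnj (C $$ (j,i)) = C $$ (i,j)" if "i < n" "j < n" for i j
    using posdef_matsD(2)[OF C] mat_adjoint_index[of i C j] Cc that by auto
  have entrywise: "mat_adjoint X = X"
    if "X \<in> carrier_mat n n" "\<And>i j. i < n \<Longrightarrow> j < n \<Longrightarrow> X $$ (i,j) = complex_of_real (g i j) * C $$ (i,j)"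
      "\<And>i j. g j i = g i j" for X and g :: "nat \<Rightarrow> nat \<Rightarrow> real"
  proof (rule eq_matI)
    fix i j assume "i < dim_row X" "j < dim_col X"
    then have ij: "i < n" "j < n" using that(1) by auto
    then have "mat_adjoint X $$ (i,j) = cnj (X $$ (j,i))" using that(1) by simp
    also have "\<dots> = complex_of_real (g i j) * C $$ (i,j)"
      unfolding that(2)[OF ij(2,1)] complex_cnj_mult Cx[OF ij] that(3)[of i j] by simp
    finally show "mat_adjoint X $$ (i,j) = X $$ (i,j)" unfolding that(2)[OF ij] .
  qed (use that(1) in auto)
  have H'h: "mat_adjoint H' = H'"
    by (rule entrywise[OF H'c H'x]) (simp_all add: mult.commute)
  have W'h: "mat_adjoint W' = W'"
    by (rule entrywise[OF W'c W'x]) (simp_all add: mult.commute)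
  have herm: "mat_adjoint (Q * X * mat_adjoint Q) = Q * X * mat_adjoint Q"
    if "X \<in> carrier_mat n n" "mat_adjoint X = X" for X
    using that Qc mat_adjoint_mult[OF mult_sq_carrier[OF Qc(1) that(1)] Qc(2)] mat_adjoint_mult[OF Qc(1) that(1)]
    by (simp add: mult_sq_assoc[of _ n] del: assoc_mult_mat)
  have carr: "Q * X * mat_adjoint Q \<in> carrier_mat n n" if "X \<in> carrier_mat n n" for X
    using that Qc by (intro mult_sq_carrier)
  show "W_mat a b A B \<in> carrier_mat n n" unfolding WQ by (rule carr[OF W'c])
  have "H_mat c a b A B \<in> unitary_mixtures n (W_mat a b A B) \<and>
      eigvals_dec (H_mat c a b A B) \<prec>\<^sub>w eigvals_dec (W_mat a b A B)"
  proof (cases "0 < a \<or> 0 < b")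
    case True
    have mix: "H_mat c a b A B \<in> unitary_mixtures n (W_mat a b A B)"
      unfolding HQ WQ H'_def W'_def
      by (intro unitary_mixtures_conj Q dCd diagonal_weights_mixture Cc s a b True c)
    have L: "0 < a / s i + b * s i" if "i < n" for i
      by (rule positive_weight[OF s[OF that] a b True])
    let ?L = "real_diag n (\<lambda>i. a / s i + b * s i)"
    have "real_diag n (\<lambda>i. 1 / (a / s i + b * s i)) * ?L = 1\<^sub>m n"
      unfolding mat_diag_diag of_real_mult[symmetric] using L
      by (intro real_diag_eq_one) (simp add: less_imp_neq[THEN not_sym])
    then have "W' \<in> posdef_mats n"
      using posdef_congruence[OF C mat_diag_dim mat_diag_dim, of "\<lambda>i. complex_of_real (1 / (a / s i + b * s i))"]
      unfolding W'_def by (metis real_diag_hermitian)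
    then have "W_mat a b A B \<in> posdef_mats n"
      unfolding WQ using posdef_congruence[OF _ Qc(2,1,4)] by simp
    then show ?thesis
      using mix unitary_mixture_weakly_majorized[OF _ mix] herm[OF H'c H'h] unfolding HQ by blast
  next
    case False
    then have "a = 0" "b = 0" "c = 0" using a b c by auto
    then have "H' = W'" using H'c W'c by (intro eq_matI) (auto simp: H'x W'x)
    then show ?thesis
      unfolding HQ WQ using unitary_mixtures_self[OF carr[OF W'c]] weakly_majorized_refl by simp
  qed
  then show "H_mat c a b A B \<in> unitary_mixtures n (W_mat a b A B)"
    "eigvals_dec (H_mat c a b A B) \<prec>\<^sub>w eigvals_dec (W_mat a b A B)" by auto
  assume c: "c = 2 * a * b"
  have "H' $$ (i,i) = W' $$ (i,i)" if "i < n" for i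
  proof -
    have "a\<^sup>2 / (s i * s i) + b\<^sup>2 * (s i * s i) + c = (a / s i + b * s i) * (a / s i + b * s i)"
      using s[OF that] by (simp add: c field_simps power2_eq_square)
    then show ?thesis unfolding H'x[OF that that] W'x[OF that that] by simp
  qed
  then have "(\<Sum>i<n. (Q * H' * mat_adjoint Q) $$ (i,i)) = (\<Sum>i<n. (Q * W' * mat_adjoint Q) $$ (i,i))"
    unfolding sum_diag_unitary_conj[OF Q H'c] sum_diag_unitary_conj[OF Q W'c] by simp
  then show "sum_list (eigvals_dec (H_mat c a b A B)) = sum_list (eigvals_dec (W_mat a b A B))"
    unfolding HQ WQ sum_list_eigvals_dec[OF carr[OF H'c] herm[OF H'c H'h]]
      sum_list_eigvals_dec[OF carr[OF W'c] herm[OF W'c W'h]]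
    by (simp only: Re_sum[symmetric])
qed

lemma identity_posdef_and_means:
  shows "1\<^sub>m n \<in> posdef_mats n" "spectral_geometric_mean (1\<^sub>m n) (1\<^sub>m n) = 1\<^sub>m n"
    "principal_sqrt (1\<^sub>m n * 1\<^sub>m n) = 1\<^sub>m n"
proof -
  show pd: "1\<^sub>m n \<in> posdef_mats n"
    using real_diag_posdef[of n "\<lambda>_. 1"] by simp
  have inv: "minv (1\<^sub>m n) = 1\<^sub>m n" by (rule minv_eqI) auto
  have root: "pd_sqrt (1\<^sub>m n) = 1\<^sub>m n" by (rule pd_sqrt_eqI[OF pd]) simp
  show "spectral_geometric_mean (1\<^sub>m n) (1\<^sub>m n) = 1\<^sub>m n"
    by (simp add: spectral_geometric_mean_def geometric_mean_def inv root)
  show "principal_sqrt (1\<^sub>m n * 1\<^sub>m n) = 1\<^sub>m n"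
    by (rule principal_sqrt_eqI[OF one_carrier_mat _ posdef_spectrum[OF pd]]) simp
qed

lemma eigvals_dec_scalar_one_dim: "eigvals_dec (complex_of_real r \<cdot>\<^sub>m 1\<^sub>m 1) = [r]"
proof -
  have "complex_of_real r \<cdot>\<^sub>m 1\<^sub>m 1 = 1\<^sub>m 1 * real_diag 1 (\<lambda>_. r) * mat_adjoint (1\<^sub>m 1)"
    by (intro eq_matI) (auto simp: mat_diag_def)
  then show ?thesis
    using eigvals_dec_spectral[OF one_in_unitary_mats, of 1 "\<lambda>_. r"] by (simp add: decreasing_def)
qed

lemma coefficient_sharp:
  assumes "2 * a * b < c"
  shows "\<not> eigvals_dec (H_mat c a b (1\<^sub>m 1) (1\<^sub>m 1)) \<prec>\<^sub>w eigvals_dec (W_mat a b (1\<^sub>m 1) (1\<^sub>m 1))"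
proof -
  have H: "H_mat c a b (1\<^sub>m 1) (1\<^sub>m 1) = complex_of_real (a\<^sup>2 + b\<^sup>2 + c) \<cdot>\<^sub>m 1\<^sub>m 1"
    unfolding H_mat_def identity_posdef_and_means by (intro eq_matI) auto
  have W: "W_mat a b (1\<^sub>m 1) (1\<^sub>m 1) = complex_of_real (a\<^sup>2 + b\<^sup>2 + 2 * a * b) \<cdot>\<^sub>m 1\<^sub>m 1"
    unfolding W_mat_def identity_posdef_and_means by (intro eq_matI) auto
  show ?thesis
    using assms unfolding H W eigvals_dec_scalar_one_dim
    by (simp add: weakly_majorized_def decreasing_def)
qed

theorem theorem3p4:
  shows
    "(\<forall>(n::nat) A B (a::real) (b::real) (c::real).
        A \<in> posdef_mats n \<longrightarrow> B \<in> posdef_mats n \<longrightarrow> 0 \<le> a \<longrightarrow> 0 \<le> b \<longrightarrow> 0 \<le> c \<longrightarrow> c \<le> 2 * a * b \<longrightarrow>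
          eigvals_dec (H_mat c a b A B) \<prec>\<^sub>w eigvals_dec (W_mat a b A B) \<and>
          (\<forall>N. unitarily_invariant_norm n N \<longrightarrow> N (H_mat c a b A B) \<le> N (W_mat a b A B)))
     \<and> (\<forall>(n::nat) A B (a::real) (b::real).
        A \<in> posdef_mats n \<longrightarrow> B \<in> posdef_mats n \<longrightarrow> 0 \<le> a \<longrightarrow> 0 \<le> b \<longrightarrow>
          eigvals_dec (H_mat (2 * a * b) a b A B) \<prec>\<^sub>m eigvals_dec (W_mat a b A B))
     \<and> (\<forall>(a::real) (b::real) (c::real). 0 < a \<longrightarrow> 0 < b \<longrightarrow> 2 * a * b < c \<longrightarrow>
          (\<exists>A \<in> posdef_mats 1. \<exists>B \<in> posdef_mats 1.
            \<not> eigvals_dec (H_mat c a b A B) \<prec>\<^sub>w eigvals_dec (W_mat a b A B)))"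
proof (intro conjI allI impI)
  fix n A B and a b c :: real
  assume h: "A \<in> posdef_mats n" "B \<in> posdef_mats n" "0 \<le> a" "0 \<le> b" "0 \<le> c" "c \<le> 2 * a * b"
  show "eigvals_dec (H_mat c a b A B) \<prec>\<^sub>w eigvals_dec (W_mat a b A B)"
    by (rule H_mat_compared_with_W_mat(3)[OF h])
  show "N (H_mat c a b A B) \<le> N (W_mat a b A B)" if "unitarily_invariant_norm n N" for N
    using unitarily_invariant_norm_mixture_le[OF that H_mat_compared_with_W_mat(2,1)[OF h]] .
next
  fix n A B and a b :: real
  assume h: "A \<in> posdef_mats n" "B \<in> posdef_mats n" "0 \<le> a" "0 \<le> b"
  then have c: "0 \<le> 2 * a * b" by simp
  show "eigvals_dec (H_mat (2 * a * b) a b A B) \<prec>\<^sub>m eigvals_dec (W_mat a b A B)"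
    unfolding majorized_def using H_mat_compared_with_W_mat(3,4)[OF h c order_refl] by simp
next
  fix a b c :: real
  assume "2 * a * b < c"
  then show "\<exists>A \<in> posdef_mats 1. \<exists>B \<in> posdef_mats 1.
      \<not> eigvals_dec (H_mat c a b A B) \<prec>\<^sub>w eigvals_dec (W_mat a b A B)"
    using coefficient_sharp identity_posdef_and_means(1) by blast
qed

end
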